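(* Let $s\in\mathbb N$ and $\boldsymbol\gamma=(\gamma_1,\dots,\gamma_s)\in(0,\infty)^s$. (i) For $\alpha=1$: $$\mathcal H(K^{\rm kor}_{1,\boldsymbol\gamma,s})\hookrightarrow\mathcal H(K^{\rm sob}_{1,\boldsymbol\gamma,s})\leftrightharpoons\mathcal H(K^{\cos}_{1,\boldsymbol\gamma,s})\leftrightharpoons\mathcal H(K^{\rm kor+\cos}_{1,\boldsymbol\gamma,s}),$$ and none of $\mathcal H(K^{\rm sob}_{1,\boldsymbol\gamma,s})$, $\mathcal H(K^{\cos}_{1,\boldsymbol\gamma,s})$, $\mathcal H(K^{\rm kor+\cos}_{1,\boldsymbol\gamma,s})$ is a subset of $\mathcal H(K^{\rm kor}_{1,\boldsymbol\gamma,s})$. (ii) For $\alpha\in\mathbb N$, $\alpha>1$: $\mathcal H(K^{\rm kor}_{\alpha,\boldsymbol\gamma,s})\hookrightarrow\mathcal H(K^{\rm kor+\cos}_{\alpha,\boldsymbol\gamma,s})$, $\mathcal H(K^{\cos}_{\alpha,\boldsymbol\gamma,s})\hookrightarrow\mathcal H(K^{\rm kor+\cos}_{\alpha,\boldsymbol\gamma,s})$, and $\mathcal H(K^{\rm kor+\cos}_{\alpha,\boldsymbol\gamma,s})\hookrightarrow\mathcal H(K^{\rm sob}_{\alpha,\boldsymbol\gamma,s})$. (iii) For real $\alpha>1/2$: $\mathcal H(K^{\cos}_{\alpha,\boldsymbol\gamma,s})\not\subset\mathcal H(K^{\rm kor}_{\alpha,\boldsymbol\gamma,s})$ and $\mathcal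 H(K^{\rm kor+\cos}_{\alpha,\boldsymbol\gamma,s})\not\subset\mathcal H(K^{\rm kor}_{\alpha,\boldsymbol\gamma,s})$; and for $\alpha\ge3/2$: $\mathcal H(K^{\rm kor+\cos}_{\alpha,\boldsymbol\gamma,s})\not\subset\mathcal H(K^{\cos}_{\alpha,\boldsymbol\gamma,s})$ and $\mathcal H(K^{\rm kor}_{\alpha,\boldsymbol\gamma,s})\not\subset\mathcal H(K^{\cos}_{\alpha,\boldsymbol\gamma,s})$.
   Context: For $\alpha>1/2$, $\gamma>0$, $h\in\mathbb Z$: $r_{\alpha,\gamma}(0)=1$, $r_{\alpha,\gamma}(h)=\gamma|h|^{-2\alpha}$ for $h\ne0$. One-dimensional kernels on $[0,1]^2$: Korobov kernel $K^{\rm kor}_{\alpha,\gamma}(x,y)=\sum_{h\in\mathbb Z}r_{\alpha,\gamma}(h)e^{2\pi i h(x-y)}$; half-period cosine kernel $K^{\cos}_{\alpha,\gamma}(x,y)=1+\sum_{k\ge1}r_{\alpha,\gamma}(k)\sqrt2\cos(\pi kx)\sqrt2\cos(\pi ky)$; sum kernel $K^{\rm kor+\cos}_{\alpha,\gamma}=\tfrac12(K^{\rm kor}_{\alpha,\gamma}+K^{\cos}_{\alpha,\gamma})$; for $\alpha\in\mathbb N$ the unanchored Sobolev kernel $K^{\rm sob}_{\alpha,\gamma}(x,y)=1+\gamma\sum_{\tau=1}^\alpha\frac{B_\tau(x)B_\tau(y)}{(\tau!)^2}-(-1)^\alpha\gamma\frac{B_{2\alpha}(|x-y|)}{(2\alpha)!}$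 with $B_\tau$ the Bernoulli polynomials. For each type, the $s$-dimensional kernel with weights $\boldsymbol\gamma$ is the product $K_{\alpha,\boldsymbol\gamma,s}(\boldsymbol x,\boldsymbol y)=\prod_{j=1}^sK_{\alpha,\gamma_j}(x_j,y_j)$, and $\mathcal H(K)$ is the reproducing kernel Hilbert space with norm $\|\cdot\|_K$. Notation: $\mathcal H(K_1)\hookrightarrow\mathcal H(K_2)$ means $\mathcal H(K_1)\subseteq\mathcal H(K_2)$ and there is $C>0$ with $\|f\|_{K_2}\le C\|f\|_{K_1}$ for all $f\in\mathcal H(K_1)$; $\mathcal H(K_1)\leftrightharpoons\mathcal H(K_2)$ means embeddings in both directions; $\mathcal H(K_1)\not\subset\mathcal H(K_2)$ means some function of $\mathcal H(K_1)$ is not in $\mathcal H(K_2)$. *)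

theory Defs
  imports "HOL-Analysis.Analysis"
begin

text \<open>Bernoulli numbers with the convention B_1 = -1/2, defined by the standard
  recursion  sum_{k=0}^{n} (n+1 choose k) B_k = 0  for n >= 1.\<close>
function bernoulli_num :: "nat \<Rightarrow> real" where
  "bernoulli_num n = (if n = 0 then 1 else
     - (\<Sum>k<n. real (Suc n choose k) * bernoulli_num k) / real (Suc n))"
  by auto
termination by (relation "Wellfounded.measure id") auto

definition bernoulli_poly :: "nat \<Rightarrow> real \<Rightarrow> real" where
  "bernoulli_poly n x = (\<Sum>k\<le>n. real (n choose k) * bernoulli_num k * x ^ (n - k))"

definition r_coef :: "real \<Rightarrow> real \<Rightarrow> int \<Rightarrow> real" where
  "r_coef \<alpha> \<gamma> h = (if h = 0 then 1 else \<gamma> * (real_of_int \<bar>h\<bar>) powr (- 2 * \<alpha>))"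

definition K_kor :: "real \<Rightarrow> real \<Rightarrow> real \<Rightarrow> real \<Rightarrow> complex" where
  "K_kor \<alpha> \<gamma> x y =
     infsum (\<lambda>h::int. complex_of_real (r_coef \<alpha> \<gamma> h) *
                        exp (2 * complex_of_real pi * \<i> * of_int h * complex_of_real (x - y))) UNIV"

definition K_cos :: "real \<Rightarrow> real \<Rightarrow> real \<Rightarrow> real \<Rightarrow> complex" where
  "K_cos \<alpha> \<gamma> x y = 1 +
     infsum (\<lambda>k::nat. complex_of_real (r_coef \<alpha> \<gamma> (int k) *
                 (sqrt 2 * cos (pi * real k * x)) * (sqrt 2 * cos (pi * real k * y)))) {1..}"

definition K_korcos :: "real \<Rightarrow> real \<Rightarrow> real \<Rightarrow> real \<Rightarrow> complex" where
  "K_korcos \<alpha> \<gamma> x y = (K_kor \<alpha> \<gamma> x y + K_cos \<alpha> \<gamma> x y) / 2"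

definition K_sob :: "nat \<Rightarrow> real \<Rightarrow> real \<Rightarrow> real \<Rightarrow> complex" where
  "K_sob \<alpha> \<gamma> x y = complex_of_real (1
     + \<gamma> * (\<Sum>\<tau>=1..\<alpha>. bernoulli_poly \<tau> x * bernoulli_poly \<tau> y / (fact \<tau>)^2)
     - (-1) ^ \<alpha> * \<gamma> * bernoulli_poly (2 * \<alpha>) \<bar>x - y\<bar> / fact (2 * \<alpha>))"

definition unit_cube :: "nat \<Rightarrow> (nat \<Rightarrow> real) set" where
  "unit_cube s = {x. (\<forall>j<s. 0 \<le> x j \<and> x j \<le> 1) \<and> (\<forall>j\<ge>s. x j = 0)}"

definition prod_kernel ::
  "(real \<Rightarrow> real \<Rightarrow> real \<Rightarrow> complex) \<Rightarrow> nat \<Rightarrow> (nat \<Rightarrow> real)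
     \<Rightarrow> (nat \<Rightarrow> real) \<Rightarrow> (nat \<Rightarrow> real) \<Rightarrow> complex" where
  "prod_kernel k s \<gamma> x y = (\<Prod>j<s. k (\<gamma> j) (x j) (y j))"

text \<open>Finitely supported coefficient families c on X represent the functions
  sum_y c(y) K(., y) of the linear span of the kernel sections.\<close>
definition fin_coeffs :: "'x set \<Rightarrow> ('x \<Rightarrow> complex) set" where
  "fin_coeffs X = {c. finite {y. c y \<noteq> 0} \<and> {y. c y \<noteq> 0} \<subseteq> X}"

definition kspan_fun :: "('x \<Rightarrow> 'x \<Rightarrow> complex) \<Rightarrow> ('x \<Rightarrow> complex) \<Rightarrow> 'x \<Rightarrow> complex" where
  "kspan_fun K c = (\<lambda>x. \<Sum>y\<in>{y. c y \<noteq> 0}. c y * K x y)"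

definition kspan_norm :: "('x \<Rightarrow> 'x \<Rightarrow> complex) \<Rightarrow> ('x \<Rightarrow> complex) \<Rightarrow> real" where
  "kspan_norm K c = sqrt (Re (\<Sum>y\<in>{y. c y \<noteq> 0}. \<Sum>z\<in>{y. c y \<noteq> 0}. c y * cnj (c z) * K z y))"

definition rkhs_approx :: "('x \<Rightarrow> 'x \<Rightarrow> complex) \<Rightarrow> 'x set \<Rightarrow> ('x \<Rightarrow> complex)
     \<Rightarrow> (nat \<Rightarrow> 'x \<Rightarrow> complex) \<Rightarrow> bool" where
  "rkhs_approx K X f c \<longleftrightarrow>
     (\<forall>n. c n \<in> fin_coeffs X) \<and>
     (\<forall>x\<in>X. (\<lambda>n. kspan_fun K (c n) x) \<longlonglongrightarrow> f x) \<and>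
     (\<forall>e>0. \<exists>N. \<forall>m\<ge>N. \<forall>n\<ge>N. kspan_norm K (c m - c n) < e)"

text \<open>H(K): functions on X (values outside X are irrelevant) obtained as pointwise
  limits of Cauchy sequences of the span; the norm is the limit of the norms.\<close>
definition rkhs :: "('x \<Rightarrow> 'x \<Rightarrow> complex) \<Rightarrow> 'x set \<Rightarrow> ('x \<Rightarrow> complex) set" where
  "rkhs K X = {f. \<exists>c. rkhs_approx K X f c}"

definition rkhs_norm :: "('x \<Rightarrow> 'x \<Rightarrow> complex) \<Rightarrow> 'x set \<Rightarrow> ('x \<Rightarrow> complex) \<Rightarrow> real" where
  "rkhs_norm K X f =
     Inf {L. \<exists>c. rkhs_approx K X f c \<and> (\<lambda>n. kspan_norm K (c n)) \<longlonglongrightarrow> L}"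

definition rkhs_embeds ::
  "('x \<Rightarrow> 'x \<Rightarrow> complex) \<Rightarrow> ('x \<Rightarrow> 'x \<Rightarrow> complex) \<Rightarrow> 'x set \<Rightarrow> bool" where
  "rkhs_embeds K1 K2 X \<longleftrightarrow> rkhs K1 X \<subseteq> rkhs K2 X \<and>
     (\<exists>C>0. \<forall>f\<in>rkhs K1 X. rkhs_norm K2 X f \<le> C * rkhs_norm K1 X f)"

definition rkhs_equiv ::
  "('x \<Rightarrow> 'x \<Rightarrow> complex) \<Rightarrow> ('x \<Rightarrow> 'x \<Rightarrow> complex) \<Rightarrow> 'x set \<Rightarrow> bool" where
  "rkhs_equiv K1 K2 X \<longleftrightarrow> rkhs_embeds K1 K2 X \<and> rkhs_embeds K2 K1 X"

definition rkhs_not_subset ::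
  "('x \<Rightarrow> 'x \<Rightarrow> complex) \<Rightarrow> ('x \<Rightarrow> 'x \<Rightarrow> complex) \<Rightarrow> 'x set \<Rightarrow> bool" where
  "rkhs_not_subset K1 K2 X \<longleftrightarrow> (\<exists>f\<in>rkhs K1 X. f \<notin> rkhs K2 X)"

end

theory Submission
  imports Defs
begin

text \<open>
  A kernel \<open>k\<close> is dominated by \<open>l\<close> if \<open>C l - k\<close> is positive semidefinite for some \<open>C\<close>. Domination of
  \<open>K\<^sub>1\<close> by \<open>K\<^sub>2\<close> yields an embedding of \<open>H(K\<^sub>1)\<close> into \<open>H(K\<^sub>2)\<close>, and a real function \<open>f\<close> lies in \<open>H(K)\<close>
  iff the rank one kernel \<open>f(x) f(y)\<close> is dominated by \<open>K\<close>. By the Schur product theorem domination passes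
  to products, and it survives restriction to a coordinate axis; so inclusions as well as non-inclusions
  reduce to kernels \<open>1 + \<gamma> k\<close> in one variable.

  Let \<open>c\<close> be a finite linear combination of point evaluations on \<open>[0,1]\<close>. The quadratic form of the
  Sobolev kernel at \<open>c\<close> is \<open>c(1)\<^sup>2 + \<gamma> (\<Sum>\<tau>\<le>a. c(B\<^sub>\<tau>/\<tau>!)\<^sup>2 + \<integral>W\<^sup>2)\<close>, where \<open>W\<close> is \<open>c\<close> applied to the periodised
  Bernoulli polynomial \<open>B\<^sub>a({x-t})/a!\<close>, and the Euler-Maclaurin formula expresses \<open>c(F)\<close> for smooth \<open>F\<close>
  through these same quantities and the integrals of the derivatives of \<open>F\<close>. Taking for \<open>F\<close> trigonometric
  sums and using the Cauchy-Schwarz inequality, one gets domination of the Korobov and cosine kernels.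
  For the cosine kernel of smoothness 1 the constant is the sharp \<open>\<pi>\<^sup>2\<close>, and a comparison of traces turns
  the inequality into the identity \<open>K\<^sup>c\<^sup>o\<^sup>s - 1 = \<pi>\<^sup>2 (K\<^sup>s\<^sup>o\<^sup>b - 1)\<close>.

  The Korobov kernel does not separate 0 and 1, but \<open>cos(\<pi>x)\<close> does. For \<open>\<alpha> \<ge> 3/2\<close> the cosine coefficients
  of \<open>sin(2\<pi>x)\<close> decay too slowly; this is detected by a sum of difference
  quotients at 0 over many scales.
\<close>

section \<open>Positive semidefinite kernels\<close>

definition weighted_sum :: "'a set \<Rightarrow> ('a \<Rightarrow> real) \<Rightarrow> ('a \<Rightarrow> real) \<Rightarrow> real" where
  "weighted_sum S c f = (\<Sum>x\<in>S. c x * f x)"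

definition quad_form :: "'a set \<Rightarrow> ('a \<Rightarrow> real) \<Rightarrow> ('a \<Rightarrow> 'a \<Rightarrow> real) \<Rightarrow> real" where
  "quad_form S c k = (\<Sum>x\<in>S. \<Sum>y\<in>S. c x * c y * k x y)"

abbreviation rank1 :: "('a \<Rightarrow> real) \<Rightarrow> 'a \<Rightarrow> 'a \<Rightarrow> real" where
  "rank1 f \<equiv> (\<lambda>x y. f x * f y)"

lemma quad_form_altdef: "quad_form S c k = weighted_sum S c (\<lambda>x. weighted_sum S c (k x))"
  by (simp add: quad_form_def weighted_sum_def sum_distrib_left mult.assoc)

lemma weighted_sum_cong: "(\<And>x. x \<in> S \<Longrightarrow> f x = g x) \<Longrightarrow> weighted_sum S c f = weighted_sum S c g"
  by (simp add: weighted_sum_def)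

lemma weighted_sum_add: "weighted_sum S c (\<lambda>x. f x + g x) = weighted_sum S c f + weighted_sum S c g"
  by (simp add: weighted_sum_def distrib_left sum.distrib)

lemma weighted_sum_diff: "weighted_sum S c (\<lambda>x. f x - g x) = weighted_sum S c f - weighted_sum S c g"
  by (simp add: weighted_sum_def right_diff_distrib sum_subtractf)

lemma weighted_sum_mult_left: "weighted_sum S c (\<lambda>x. a * f x) = a * weighted_sum S c f"
  by (simp add: weighted_sum_def sum_distrib_left mult.left_commute)

lemma weighted_sum_mult_right: "weighted_sum S c (\<lambda>x. f x * a) = weighted_sum S c f * a"
  using weighted_sum_mult_left[of S c a f] by (simp add: mult.commute)

lemma weighted_sum_sum: "weighted_sum S c (\<lambda>x. \<Sum>i\<in>I. f i x) = (\<Sum>i\<in>I. weighted_sum S c (f i))"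
  unfolding weighted_sum_def sum_distrib_left by (rule sum.swap)

lemma weighted_sum_image:
  assumes "finite S"
  shows "weighted_sum (g ` S) (\<lambda>u. \<Sum>x | x \<in> S \<and> g x = u. c x) f = weighted_sum S c (\<lambda>x. f (g x))"
  unfolding weighted_sum_def sum.image_gen[OF assms, of "\<lambda>x. c x * f (g x)" g]
  by (simp add: sum_distrib_right)

lemma quad_form_cong:
  "(\<And>x y. x \<in> S \<Longrightarrow> y \<in> S \<Longrightarrow> k x y = l x y) \<Longrightarrow> quad_form S c k = quad_form S c l"
  by (simp add: quad_form_def)

lemma quad_form_add: "quad_form S c (\<lambda>x y. k x y + l x y) = quad_form S c k + quad_form S c l"
  by (simp add: quad_form_altdef weighted_sum_add)

lemma quad_form_diff: "quad_form S c (\<lambda>x y. k x y - l x y) = quad_form S c k - quad_form S c l"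
  by (simp add: quad_form_altdef weighted_sum_diff)

lemma quad_form_scale: "quad_form S c (\<lambda>x y. a * k x y) = a * quad_form S c k"
  by (simp add: quad_form_altdef weighted_sum_mult_left)

lemma quad_form_sum: "quad_form S c (\<lambda>x y. \<Sum>i\<in>I. k i x y) = (\<Sum>i\<in>I. quad_form S c (k i))"
  by (simp add: quad_form_altdef weighted_sum_sum)

lemma quad_form_rank1: "quad_form S c (rank1 f) = (weighted_sum S c f)\<^sup>2"
  by (simp add: quad_form_altdef weighted_sum_mult_left weighted_sum_mult_right power2_eq_square)

lemma quad_form_rank1_mult:
  "quad_form S c (\<lambda>x y. f x * f y * k x y) = quad_form S (\<lambda>x. c x * f x) k"
  by (simp add: quad_form_def mult_ac)

lemma quad_form_pullback:
  assumes "finite S"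
  shows "quad_form S c (\<lambda>x y. k (g x) (g y)) = quad_form (g ` S) (\<lambda>u. \<Sum>x | x \<in> S \<and> g x = u. c x) k"
  by (simp add: quad_form_altdef weighted_sum_image[OF assms])

definition psd_on :: "'a set \<Rightarrow> ('a \<Rightarrow> 'a \<Rightarrow> real) \<Rightarrow> bool" where
  "psd_on X k \<longleftrightarrow> (\<forall>x\<in>X. \<forall>y\<in>X. k x y = k y x) \<and>
     (\<forall>S c. finite S \<longrightarrow> S \<subseteq> X \<longrightarrow> 0 \<le> quad_form S c k)"

lemma psd_onI:
  assumes "\<And>x y. x \<in> X \<Longrightarrow> y \<in> X \<Longrightarrow> k x y = k y x"
    and "\<And>S c. finite S \<Longrightarrow> S \<subseteq> X \<Longrightarrow> 0 \<le> quad_form S c k"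
  shows "psd_on X k"
  using assms by (auto simp: psd_on_def)

lemma psd_on_sym: "psd_on X k \<Longrightarrow> x \<in> X \<Longrightarrow> y \<in> X \<Longrightarrow> k x y = k y x"
  by (auto simp: psd_on_def)

lemma quad_form_nonneg: "psd_on X k \<Longrightarrow> finite S \<Longrightarrow> S \<subseteq> X \<Longrightarrow> 0 \<le> quad_form S c k"
  by (auto simp: psd_on_def)

lemma psd_on_diag_nonneg: "psd_on X k \<Longrightarrow> x \<in> X \<Longrightarrow> 0 \<le> k x x"
  using quad_form_nonneg[of X k "{x}" "\<lambda>_. 1"] by (simp add: quad_form_def)

lemma psd_on_subset: "psd_on Y k \<Longrightarrow> X \<subseteq> Y \<Longrightarrow> psd_on X k"
  unfolding psd_on_def by blast

lemma psd_on_add: "psd_on X k \<Longrightarrow> psd_on X l \<Longrightarrow> psd_on X (\<lambda>x y. k x y + l x y)"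
  by (simp add: psd_on_def quad_form_add)

lemma psd_on_scale: "psd_on X k \<Longrightarrow> 0 \<le> a \<Longrightarrow> psd_on X (\<lambda>x y. a * k x y)"
  by (simp add: psd_on_def quad_form_scale)

lemma psd_on_rank1: "psd_on X (rank1 f)"
  by (rule psd_onI) (auto simp: quad_form_rank1)

lemma psd_on_one: "psd_on X (\<lambda>x y. 1)"
  using psd_on_rank1[of X "\<lambda>_. 1"] by simp

lemma quadratic_nonneg_imp_discriminant:
  fixes a b e :: real
  assumes "\<And>t. 0 \<le> a + 2 * t * b + t\<^sup>2 * e" and "0 \<le> e"
  shows "b\<^sup>2 \<le> a * e"
proof (cases "e = 0")
  case True
  have "b = 0"
  proof (rule ccontr)
    assume "b \<noteq> 0"
    have "0 \<le> a + 2 * (- (a + 1) / (2 * b)) * b" using assms(1)[of "- (a + 1) / (2 * b)"] True by simp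
    thus False using \<open>b \<noteq> 0\<close> by (simp add: field_simps)
  qed
  thus ?thesis using True by simp
next
  case False
  hence e: "e > 0" using assms(2) by simp
  have "0 \<le> a + 2 * (- b / e) * b + (- b / e)\<^sup>2 * e" by (rule assms(1))
  also have "\<dots> = a - b\<^sup>2 / e" using e by (simp add: field_simps power2_eq_square)
  finally show ?thesis using e by (simp add: field_simps)
qed

lemma psd_on_Cauchy_Schwarz:
  assumes k: "psd_on X k" and S: "finite S" "S \<subseteq> X" and a: "a \<in> X"
  shows "(weighted_sum S c (\<lambda>x. k x a))\<^sup>2 \<le> quad_form S c k * k a a"
proof (rule quadratic_nonneg_imp_discriminant)
  fix t :: real
  define e where "e x = (if x \<in> S then c x else 0) + (if x = a then t else 0)" for x
  have e: "weighted_sum (insert a S) e f = weighted_sum S c f + t * f a" for f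
  proof -
    have "weighted_sum (insert a S) e f =
      (\<Sum>x\<in>insert a S. (if x \<in> S then c x * f x else 0)) 
      + (\<Sum>x\<in>insert a S. (if x = a then t * f x else 0))"
      unfolding weighted_sum_def sum.distrib[symmetric]
      by (intro sum.cong) (auto simp: e_def distrib_right)
    also have "(\<Sum>x\<in>insert a S. (if x \<in> S then c x * f x else 0)) = weighted_sum S c f"
      unfolding weighted_sum_def by (intro sum.mono_neutral_cong_right) (use S in auto)
    finally show ?thesis using S by simp
  qed
  have "0 \<le> quad_form (insert a S) e k" by (rule quad_form_nonneg[OF k]) (use S a in auto)
  also have "\<dots> =
      quad_form S c k + t * weighted_sum S c (\<lambda>x. k x a) + t * weighted_sum S c (k a) + t\<^sup>2 * k a a"
    by (simp add: quad_form_altdef e weighted_sum_add weighted_sum_mult_left power2_eq_square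
      algebra_simps)
  also have "weighted_sum S c (k a) = weighted_sum S c (\<lambda>x. k x a)"
    using psd_on_sym[OF k a] S by (intro weighted_sum_cong) blast
  finally show "0 \<le> quad_form S c k + 2 * t * weighted_sum S c (\<lambda>x. k x a) + t\<^sup>2 * k a a" by simp
qed (rule psd_on_diag_nonneg[OF k a])

lemma psd_on_power2_le:
  assumes "psd_on X k" "x \<in> X" "y \<in> X"
  shows "(k x y)\<^sup>2 \<le> k x x * k y y"
  using psd_on_Cauchy_Schwarz[OF assms(1), of "{x}" y "\<lambda>_. 1"] assms
  by (simp add: weighted_sum_def quad_form_def)

text \<open>If \<open>k a a = 0\<close>, the quotient is 0, and so is \<open>k x a\<close> by the Cauchy-Schwarz inequality.\<close>

lemma psd_on_Schur_complement:
  assumes k: "psd_on X k" and a: "a \<in> X"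
  shows "psd_on X (\<lambda>x y. k x y - k x a * k y a / k a a)"
proof (rule psd_onI)
  fix S c assume S: "finite S" "S \<subseteq> X"
  have "quad_form S c (\<lambda>x y. k x y - k x a * k y a / k a a) =
      quad_form S c (\<lambda>x y. k x y - (1 / k a a) * (k x a * k y a))" by simp
  also have "\<dots> = quad_form S c k - (weighted_sum S c (\<lambda>x. k x a))\<^sup>2 / k a a"
    unfolding quad_form_diff quad_form_scale quad_form_rank1 by simp
  finally show "0 \<le> quad_form S c (\<lambda>x y. k x y - k x a * k y a / k a a)"
    using psd_on_Cauchy_Schwarz[OF k S a, of c] psd_on_diag_nonneg[OF k a] quad_form_nonneg[OF k S, of c]
    by (cases "k a a = 0") (auto simp: divide_le_eq)
next
  fix x y assume "x \<in> X" "y \<in> X"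
  thus "k x y - k x a * k y a / k a a = k y x - k y a * k x a / k a a"
    using psd_on_sym[OF k] by (simp add: mult.commute)
qed

lemma psd_on_finite_Gram:
  assumes "finite X" "psd_on X k"
  shows "\<exists>f n. \<forall>x\<in>X. \<forall>y\<in>X. k x y = (\<Sum>i<(n::nat). f i x * f i y)"
  using assms
proof (induction X arbitrary: k rule: finite_induct)
  case (insert a X)
  define l where "l x y = k x y - k x a * k y a / k a a" for x y
  have "psd_on X l"
    using psd_on_Schur_complement[OF insert.prems, of a] unfolding l_def by (rule psd_on_subset) auto
  then obtain f :: "nat \<Rightarrow> 'a \<Rightarrow> real" and n where f: "\<And>x y. x \<in> X \<Longrightarrow> y \<in> X \<Longrightarrow> l x y = (\<Sum>i<n. f i x * f i y)"
    using insert.IH by metis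
  define g where "g i x = (if i = n then k x a / sqrt (k a a) else if x = a then 0 else f i x)" for i x
  have "k x y = (\<Sum>i<Suc n. g i x * g i y)" if x: "x \<in> insert a X" and y: "y \<in> insert a X" for x y
  proof -
    have row: "k x a = 0" if "k a a = 0" "x \<in> insert a X" for x
      using psd_on_power2_le[OF insert.prems that(2), of a] that(1) by simp
    have "g n x * g n y = k x a * k y a / k a a"
      using psd_on_diag_nonneg[OF insert.prems, of a] by (simp add: g_def)
    moreover have "(\<Sum>i<n. g i x * g i y) = l x y"
    proof (cases "x = a \<or> y = a")
      case True
      moreover have "l a z = 0" "l z a = 0" if "z \<in> insert a X" for z
        using row[OF _ that] psd_on_sym[OF insert.prems that, of a] by (auto simp: l_def)
      ultimately show ?thesis using x y by (auto simp: g_def)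
    next
      case False
      thus ?thesis using x y by (simp add: f g_def)
    qed
    ultimately show ?thesis by (simp add: l_def)
  qed
  thus ?case by blast
qed simp

lemma psd_on_mult:
  assumes k: "psd_on X k" and l: "psd_on X l"
  shows "psd_on X (\<lambda>x y. k x y * l x y)"
proof (rule psd_onI)
  fix S c assume S: "finite S" "S \<subseteq> X"
  then obtain f :: "nat \<Rightarrow> 'a \<Rightarrow> real" and n
    where f: "\<And>x y. x \<in> S \<Longrightarrow> y \<in> S \<Longrightarrow> k x y = (\<Sum>i<n. f i x * f i y)"
    using psd_on_finite_Gram[of S k] psd_on_subset[OF k] by metis
  have "quad_form S c (\<lambda>x y. k x y * l x y) = quad_form S c (\<lambda>x y. \<Sum>i<n. f i x * f i y * l x y)"
    by (rule quad_form_cong) (simp add: f sum_distrib_right)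
  also have "\<dots> = (\<Sum>i<n. quad_form S (\<lambda>x. c x * f i x) l)"
    by (simp add: quad_form_sum quad_form_rank1_mult)
  finally show "0 \<le> quad_form S c (\<lambda>x y. k x y * l x y)"
    using quad_form_nonneg[OF l S] by (simp add: sum_nonneg)
qed (use psd_on_sym[OF k] psd_on_sym[OF l] in metis)

lemma psd_on_pullback:
  assumes k: "psd_on Y k" and g: "g ` X \<subseteq> Y"
  shows "psd_on X (\<lambda>x y. k (g x) (g y))"
proof (rule psd_onI)
  fix S c assume "finite S" "S \<subseteq> X"
  thus "0 \<le> quad_form S c (\<lambda>x y. k (g x) (g y))"
    using g by (subst quad_form_pullback) (auto intro!: quad_form_nonneg[OF k])
qed (use psd_on_sym[OF k] g in blast)

section \<open>Domination of kernels\<close>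

definition form_le_on :: "'a set \<Rightarrow> real \<Rightarrow> ('a \<Rightarrow> 'a \<Rightarrow> real) \<Rightarrow> ('a \<Rightarrow> 'a \<Rightarrow> real) \<Rightarrow> bool" where
  "form_le_on X C k l \<longleftrightarrow> (\<forall>S c. finite S \<longrightarrow> S \<subseteq> X \<longrightarrow> quad_form S c k \<le> C * quad_form S c l)"

lemma form_le_onD:
  "form_le_on X C k l \<Longrightarrow> finite S \<Longrightarrow> S \<subseteq> X \<Longrightarrow> quad_form S c k \<le> C * quad_form S c l"
  by (simp add: form_le_on_def)

lemma form_le_on_pullback:
  assumes "form_le_on Y C k l" "g ` X \<subseteq> Y"
  shows "form_le_on X C (\<lambda>x y. k (g x) (g y)) (\<lambda>x y. l (g x) (g y))"
  unfolding form_le_on_def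
proof (intro allI impI)
  fix S c assume S: "finite S" "S \<subseteq> X"
  show "quad_form S c (\<lambda>x y. k (g x) (g y)) \<le> C * quad_form S c (\<lambda>x y. l (g x) (g y))"
    unfolding quad_form_pullback[OF S(1)] by (rule form_le_onD[OF assms(1)]) (use S assms(2) in auto)
qed

definition dominated_on :: "'a set \<Rightarrow> ('a \<Rightarrow> 'a \<Rightarrow> real) \<Rightarrow> ('a \<Rightarrow> 'a \<Rightarrow> real) \<Rightarrow> bool" where
  "dominated_on X k l \<longleftrightarrow> psd_on X k \<and> psd_on X l \<and> (\<exists>C>0. form_le_on X C k l)"

lemma dominated_onI:
  assumes "psd_on X k" "psd_on X l" "0 \<le> C"
    and "\<And>S c. finite S \<Longrightarrow> S \<subseteq> X \<Longrightarrow> quad_form S c k \<le> C * quad_form S c l"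
  shows "dominated_on X k l"
proof -
  have "quad_form S c k \<le> (C + 1) * quad_form S c l" if "finite S" "S \<subseteq> X" for S c
    using assms(4)[OF that, of c] quad_form_nonneg[OF assms(2) that, of c] by (simp add: distrib_right)
  thus ?thesis
    using assms(1-3) unfolding dominated_on_def form_le_on_def by (intro conjI exI[of _ "C + 1"]) auto
qed

lemma dominated_onE:
  assumes "dominated_on X k l"
  obtains C where "C > 0" "form_le_on X C k l"
  using assms by (auto simp: dominated_on_def)

lemma dominated_on_psd:
  assumes "dominated_on X k l"
  shows "psd_on X k" "psd_on X l"
  using assms by (auto simp: dominated_on_def)

lemma dominated_on_refl: "psd_on X k \<Longrightarrow> dominated_on X k k"
  by (rule dominated_onI[of _ _ _ 1]) auto

lemma dominated_on_trans:
  assumes kl: "dominated_on X k l" and lm: "dominated_on X l m"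
  shows "dominated_on X k m"
proof -
  obtain C where C: "C > 0" "form_le_on X C k l" by (rule dominated_onE[OF kl])
  obtain D where D: "D > 0" "form_le_on X D l m" by (rule dominated_onE[OF lm])
  show ?thesis
  proof (rule dominated_onI[of _ _ _ "C * D"])
    fix S c assume S: "finite S" "S \<subseteq> X"
    have "quad_form S c k \<le> C * quad_form S c l" by (rule form_le_onD[OF C(2) S])
    also have "\<dots> \<le> C * (D * quad_form S c m)" using C(1) form_le_onD[OF D(2) S] by (intro mult_left_mono) auto
    finally show "quad_form S c k \<le> C * D * quad_form S c m" by (simp add: mult.assoc)
  qed (use C D dominated_on_psd[OF kl] dominated_on_psd[OF lm] in auto)
qed

lemma dominated_on_scale:
  assumes "psd_on X k" "a > 0" "b > 0"
  shows "dominated_on X (\<lambda>x y. a * k x y) (\<lambda>x y. b * k x y)"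
  using assms by (intro dominated_onI[of _ _ _ "a / b"] psd_on_scale) (auto simp: quad_form_scale)

lemma dominated_on_add:
  assumes "dominated_on X k m" "dominated_on X l m"
  shows "dominated_on X (\<lambda>x y. k x y + l x y) m"
proof -
  obtain C where C: "C > 0" "form_le_on X C k m" by (rule dominated_onE[OF assms(1)])
  obtain D where D: "D > 0" "form_le_on X D l m" by (rule dominated_onE[OF assms(2)])
  show ?thesis
    using C D assms[THEN dominated_on_psd(1)] dominated_on_psd(2)[OF assms(1)]
    by (intro dominated_onI[of _ _ _ "C + D"] psd_on_add)
      (auto simp: quad_form_add distrib_right intro: add_mono form_le_onD)
qed

lemma dominated_on_add_right: "psd_on X k \<Longrightarrow> psd_on X l \<Longrightarrow> dominated_on X k (\<lambda>x y. k x y + l x y)"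
  by (rule dominated_onI[of _ _ _ 1]) (auto simp: quad_form_add intro: psd_on_add quad_form_nonneg)

lemma dominated_on_pullback:
  assumes kl: "dominated_on Y k l" and g: "g ` X \<subseteq> Y"
  shows "dominated_on X (\<lambda>x y. k (g x) (g y)) (\<lambda>x y. l (g x) (g y))"
proof -
  obtain C where C: "C > 0" "form_le_on Y C k l" by (rule dominated_onE[OF kl])
  thus ?thesis
    using form_le_on_pullback[OF C(2) g] dominated_on_psd[OF kl, THEN psd_on_pullback, OF g]
    unfolding dominated_on_def by blast
qed

lemma dominated_on_mult_left:
  assumes kl: "dominated_on X k l" and m: "psd_on X m"
  shows "dominated_on X (\<lambda>x y. k x y * m x y) (\<lambda>x y. l x y * m x y)"
proof -
  obtain C where C: "C > 0" "form_le_on X C k l" by (rule dominated_onE[OF kl])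
  note psd = dominated_on_psd[OF kl]
  have "psd_on X (\<lambda>x y. C * l x y - k x y)"
    using form_le_onD[OF C(2)] psd[THEN psd_on_sym]
    by (intro psd_onI) (auto simp: quad_form_diff quad_form_scale)
  hence diff: "psd_on X (\<lambda>x y. (C * l x y - k x y) * m x y)" using m by (rule psd_on_mult)
  show ?thesis
  proof (rule dominated_onI)
    fix S c assume S: "finite S" "S \<subseteq> X"
    from quad_form_nonneg[OF diff S, of c]
    show "quad_form S c (\<lambda>x y. k x y * m x y) \<le> C * quad_form S c (\<lambda>x y. l x y * m x y)"
      by (simp add: left_diff_distrib quad_form_diff mult.assoc quad_form_scale)
  qed (use C psd m in \<open>auto intro: psd_on_mult\<close>)
qed

lemma dominated_on_mult:
  assumes "dominated_on X k l" "dominated_on X k' l'"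
  shows "dominated_on X (\<lambda>x y. k x y * k' x y) (\<lambda>x y. l x y * l' x y)"
proof (rule dominated_on_trans)
  show "dominated_on X (\<lambda>x y. k x y * k' x y) (\<lambda>x y. l x y * k' x y)"
    using assms by (intro dominated_on_mult_left dominated_on_psd(1))
  show "dominated_on X (\<lambda>x y. l x y * k' x y) (\<lambda>x y. l x y * l' x y)"
    using dominated_on_mult_left[OF assms(2) dominated_on_psd(2)[OF assms(1)]]
    by (simp add: mult.commute)
qed

lemma dominated_on_prod:
  assumes "\<And>j. j < (s::nat) \<Longrightarrow> dominated_on X (k j) (l j)"
  shows "dominated_on X (\<lambda>x y. \<Prod>j<s. k j x y) (\<lambda>x y. \<Prod>j<s. l j x y)"
  using assms by (induction s) (auto intro: dominated_on_mult dominated_on_refl[OF psd_on_one])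

lemma dominated_on_cube:
  assumes "\<And>j. j < s \<Longrightarrow> dominated_on {0..1} (k j) (l j)"
  shows "dominated_on (unit_cube s) (\<lambda>x y. \<Prod>j<s. k j (x j) (y j)) (\<lambda>x y. \<Prod>j<s. l j (x j) (y j))"
  by (rule dominated_on_prod, rule dominated_on_pullback, rule assms) (auto simp: unit_cube_def)

lemma dominated_on_rank1_eqI:
  assumes "dominated_on X (rank1 f) k" "p \<in> X" "q \<in> X" "k p p + k q q = 2 * k p q"
  shows "f p = f q"
proof (cases "p = q")
  case False
  obtain C where C: "form_le_on X C (rank1 f) k" by (rule dominated_onE[OF assms(1)])
  have "(f p - f q)\<^sup>2 \<le> C * (k p p + k q q - 2 * k p q)"
    using form_le_onD[OF C, of "{p, q}" "\<lambda>x. if x = p then 1 else -1"] assms(2,3) False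
      psd_on_sym[OF dominated_on_psd(2)[OF assms(1)], of p q]
    by (simp add: quad_form_rank1) (simp add: quad_form_def weighted_sum_def algebra_simps)
  thus ?thesis using assms(4) by simp
qed simp

section \<open>Reproducing kernel Hilbert spaces through the dual bound\<close>

definition pairing :: "('x \<Rightarrow> complex) \<Rightarrow> ('x \<Rightarrow> complex) \<Rightarrow> real" where
  "pairing d f = Re (\<Sum>z\<in>{z. d z \<noteq> 0}. cnj (d z) * f z)"

definition add_scaled :: "('x \<Rightarrow> complex) \<Rightarrow> real \<Rightarrow> ('x \<Rightarrow> complex) \<Rightarrow> 'x \<Rightarrow> complex" where
  "add_scaled c t d = (\<lambda>x. c x + of_real t * d x)"

lemma diff_eq_add_scaled: "c - d = add_scaled c (- 1) d"
  by (auto simp: add_scaled_def)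

lemma add_scaled_fin_coeffs:
  assumes "c \<in> fin_coeffs X" "d \<in> fin_coeffs X"
  shows "add_scaled c t d \<in> fin_coeffs X"
proof -
  have "{y. add_scaled c t d y \<noteq> 0} \<subseteq> {y. c y \<noteq> 0} \<union> {y. d y \<noteq> 0}" by (auto simp: add_scaled_def)
  thus ?thesis using assms by (auto simp: fin_coeffs_def intro: finite_subset)
qed

lemma common_support:
  assumes "c \<in> fin_coeffs X" "d \<in> fin_coeffs X"
  obtains S where "finite S" "S \<subseteq> X" "{z. c z \<noteq> 0} \<subseteq> S" "{z. d z \<noteq> 0} \<subseteq> S"
  using assms that[of "{z. c z \<noteq> 0} \<union> {z. d z \<noteq> 0}"] by (auto simp: fin_coeffs_def)

lemma pairing_superset:
  assumes "finite S" "{z. d z \<noteq> 0} \<subseteq> S"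
  shows "pairing d f = Re (\<Sum>z\<in>S. cnj (d z) * f z)"
  unfolding pairing_def by (rule arg_cong[of _ _ Re], rule sum.mono_neutral_left) (use assms in auto)

lemma kspan_fun_superset:
  assumes "finite S" "{z. c z \<noteq> 0} \<subseteq> S"
  shows "kspan_fun K c x = (\<Sum>y\<in>S. c y * K x y)"
  unfolding kspan_fun_def by (rule sum.mono_neutral_left) (use assms in auto)

lemma pairing_add_scaled_left:
  assumes "c \<in> fin_coeffs X" "d \<in> fin_coeffs X"
  shows "pairing (add_scaled c t d) f = pairing c f + t * pairing d f"
proof -
  obtain S where S: "finite S" "{z. c z \<noteq> 0} \<subseteq> S" "{z. d z \<noteq> 0} \<subseteq> S" using common_support[OF assms] .
  moreover have "{z. add_scaled c t d z \<noteq> 0} \<subseteq> S" using S(2,3) by (force simp: add_scaled_def)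
  ultimately show ?thesis
    by (simp add: pairing_superset add_scaled_def sum_distrib_left algebra_simps flip: sum.distrib)
qed

lemma kspan_fun_add_scaled:
  assumes "c \<in> fin_coeffs X" "d \<in> fin_coeffs X"
  shows "kspan_fun K (add_scaled c t d) x = kspan_fun K c x + of_real t * kspan_fun K d x"
proof -
  obtain S where S: "finite S" "{z. c z \<noteq> 0} \<subseteq> S" "{z. d z \<noteq> 0} \<subseteq> S" using common_support[OF assms] .
  moreover have "{z. add_scaled c t d z \<noteq> 0} \<subseteq> S" using S(2,3) by (force simp: add_scaled_def)
  ultimately show ?thesis
    by (simp add: kspan_fun_superset add_scaled_def sum_distrib_left algebra_simps flip: sum.distrib)
qed

lemma pairing_add_scaled_right:
  "pairing e (\<lambda>x. f x + of_real t * g x) = pairing e f + t * pairing e g"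
  by (simp add: pairing_def sum_distrib_left algebra_simps flip: sum.distrib)

lemma kspan_norm_eq_sqrt_pairing: "kspan_norm K c = sqrt (pairing c (kspan_fun K c))"
  unfolding kspan_norm_def pairing_def kspan_fun_def sum_distrib_left
  by (subst sum.swap) (simp only: mult.left_commute mult.assoc)

locale psd_kernel =
  fixes X :: "'x set" and K :: "'x \<Rightarrow> 'x \<Rightarrow> complex"
  assumes hermitian: "x \<in> X \<Longrightarrow> y \<in> X \<Longrightarrow> K y x = cnj (K x y)"
    and pairing_self_nonneg: "c \<in> fin_coeffs X \<Longrightarrow> 0 \<le> pairing c (kspan_fun K c)"
begin

abbreviation "V \<equiv> fin_coeffs X"
abbreviation "N \<equiv> kspan_norm K"
abbreviation "fn \<equiv> kspan_fun K"

lemma kspan_norm_nonneg: "c \<in> V \<Longrightarrow> 0 \<le> N c"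
  by (simp add: kspan_norm_eq_sqrt_pairing pairing_self_nonneg)

lemma pairing_self: "c \<in> V \<Longrightarrow> pairing c (fn c) = (N c)\<^sup>2"
  by (simp add: kspan_norm_eq_sqrt_pairing pairing_self_nonneg)

lemma pairing_kspan_fun_commute:
  assumes "c \<in> V" "d \<in> V"
  shows "pairing d (fn c) = pairing c (fn d)"
proof -
  obtain S where S: "finite S" "S \<subseteq> X" "{z. c z \<noteq> 0} \<subseteq> S" "{z. d z \<noteq> 0} \<subseteq> S"
    using common_support[OF assms] .
  have "cnj (\<Sum>z\<in>S. cnj (d z) * (\<Sum>y\<in>S. c y * K z y)) = (\<Sum>z\<in>S. \<Sum>y\<in>S. cnj (c y) * (d z * K y z))"
    unfolding cnj_sum complex_cnj_mult sum_distrib_left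
  proof (intro sum.cong refl)
    fix z y assume "z \<in> S" "y \<in> S"
    hence "K y z = cnj (K z y)" using S(2) by (intro hermitian) auto
    thus "cnj (cnj (d z)) * (cnj (c y) * cnj (K z y)) = cnj (c y) * (d z * K y z)" by simp
  qed
  also have "\<dots> = (\<Sum>y\<in>S. cnj (c y) * (\<Sum>z\<in>S. d z * K y z))"
    unfolding sum_distrib_left by (rule sum.swap)
  finally have "Re (cnj (\<Sum>z\<in>S. cnj (d z) * (\<Sum>y\<in>S. c y * K z y))) =
      Re (\<Sum>y\<in>S. cnj (c y) * (\<Sum>z\<in>S. d z * K y z))"
    by (rule arg_cong)
  thus ?thesis
    unfolding pairing_superset[OF S(1,3)] pairing_superset[OF S(1,4)]
      kspan_fun_superset[OF S(1,3)] kspan_fun_superset[OF S(1,4)] cnj.sel(1) .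
qed

lemma kspan_norm_add_scaled:
  assumes "c \<in> V" "d \<in> V"
  shows "(N (add_scaled c t d))\<^sup>2 = (N c)\<^sup>2 + 2 * t * pairing d (fn c) + t\<^sup>2 * (N d)\<^sup>2"
proof -
  have "(N (add_scaled c t d))\<^sup>2 = pairing (add_scaled c t d) (\<lambda>x. fn c x + of_real t * fn d x)"
    unfolding pairing_self[OF add_scaled_fin_coeffs[OF assms], symmetric]
    by (rule arg_cong[of _ _ "pairing _"]) (simp add: fun_eq_iff kspan_fun_add_scaled[OF assms])
  also have "\<dots> = pairing c (fn c) + t * pairing d (fn c) + t * (pairing c (fn d) + t * pairing d (fn d))"
    by (simp only: pairing_add_scaled_left[OF assms] pairing_add_scaled_right)
  also have "pairing c (fn d) = pairing d (fn c)" by (rule pairing_kspan_fun_commute) (use assms in auto)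
  finally show ?thesis using assms by (simp add: pairing_self power2_eq_square algebra_simps)
qed

lemma pairing_kspan_fun_le:
  assumes "c \<in> V" "d \<in> V"
  shows "\<bar>pairing d (fn c)\<bar> \<le> N c * N d"
proof -
  have "(pairing d (fn c))\<^sup>2 \<le> (N c)\<^sup>2 * (N d)\<^sup>2"
  proof (rule quadratic_nonneg_imp_discriminant)
    show "0 \<le> (N c)\<^sup>2 + 2 * t * pairing d (fn c) + t\<^sup>2 * (N d)\<^sup>2" for t
      unfolding kspan_norm_add_scaled[OF assms, symmetric] by simp
  qed simp
  hence "(pairing d (fn c))\<^sup>2 \<le> (N c * N d)\<^sup>2" by (simp add: power_mult_distrib)
  thus ?thesis using kspan_norm_nonneg assms by (simp add: abs_le_square_iff[symmetric])
qed

lemma kspan_norm_reverse_triangle: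
  assumes "c \<in> V" "d \<in> V"
  shows "\<bar>N c - N d\<bar> \<le> N (c - d)"
proof -
  have "\<bar>N c - N d\<bar>\<^sup>2 \<le> (N c)\<^sup>2 - 2 * pairing d (fn c) + (N d)\<^sup>2"
    using pairing_kspan_fun_le[OF assms] by (simp add: power2_diff)
  also have "\<dots> = (N (c - d))\<^sup>2"
    unfolding diff_eq_add_scaled by (simp add: kspan_norm_add_scaled[OF assms])
  finally show ?thesis
    by (rule power2_le_imp_le)
      (simp add: diff_eq_add_scaled add_scaled_fin_coeffs assms kspan_norm_nonneg)
qed

lemma rkhs_approx_coeffs: "rkhs_approx K X f c \<Longrightarrow> c n \<in> V"
  by (simp add: rkhs_approx_def)

lemma rkhs_approx_norm_convergent:
  assumes "rkhs_approx K X f c"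
  obtains L where "(\<lambda>n. N (c n)) \<longlonglongrightarrow> L"
proof -
  have "Cauchy (\<lambda>n. N (c n))"
  proof (rule metric_CauchyI)
    fix e :: real assume "e > 0"
    then obtain M where "\<forall>m\<ge>M. \<forall>n\<ge>M. N (c m - c n) < e" using assms by (auto simp: rkhs_approx_def)
    thus "\<exists>M. \<forall>m\<ge>M. \<forall>n\<ge>M. dist (N (c m)) (N (c n)) < e"
      using kspan_norm_reverse_triangle[OF assms[THEN rkhs_approx_coeffs] assms[THEN rkhs_approx_coeffs]]
      unfolding dist_real_def by (meson le_less_trans)
  qed
  thus ?thesis using that by (auto simp: Cauchy_convergent_iff convergent_def)
qed

lemma rkhs_approx_norm_limit_nonneg:
  "rkhs_approx K X f c \<Longrightarrow> (\<lambda>n. N (c n)) \<longlonglongrightarrow> L \<Longrightarrow> 0 \<le> L"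
  using kspan_norm_nonneg[OF rkhs_approx_coeffs] by (intro LIMSEQ_le_const) blast+

lemma rkhs_approx_abs_pairing_le:
  assumes f: "rkhs_approx K X f c" and L: "(\<lambda>n. N (c n)) \<longlonglongrightarrow> L" and d: "d \<in> V"
  shows "\<bar>pairing d f\<bar> \<le> L * N d"
proof (rule LIMSEQ_le)
  show "(\<lambda>n. \<bar>pairing d (fn (c n))\<bar>) \<longlonglongrightarrow> \<bar>pairing d f\<bar>"
    unfolding pairing_def
    by (intro tendsto_rabs tendsto_Re tendsto_sum tendsto_mult tendsto_const)
       (use f d in \<open>auto simp: rkhs_approx_def fin_coeffs_def\<close>)
  show "(\<lambda>n. N (c n) * N d) \<longlonglongrightarrow> L * N d" by (intro tendsto_intros L)
  show "\<exists>M. \<forall>n\<ge>M. \<bar>pairing d (fn (c n))\<bar> \<le> N (c n) * N d"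
    using pairing_kspan_fun_le[OF rkhs_approx_coeffs[OF f] d] by blast
qed

lemma rkhs_norm_greatest:
  assumes f: "f \<in> rkhs K X"
    and le: "\<And>c L. rkhs_approx K X f c \<Longrightarrow> (\<lambda>n. N (c n)) \<longlonglongrightarrow> L \<Longrightarrow> b \<le> L"
  shows "b \<le> rkhs_norm K X f"
proof -
  obtain c where c: "rkhs_approx K X f c" using f by (auto simp: rkhs_def)
  then obtain L where "(\<lambda>n. N (c n)) \<longlonglongrightarrow> L" by (rule rkhs_approx_norm_convergent)
  thus ?thesis unfolding rkhs_norm_def using c le by (intro cInf_greatest) auto
qed

lemma rkhs_norm_le:
  assumes "rkhs_approx K X f c" "(\<lambda>n. N (c n)) \<longlonglongrightarrow> L"
  shows "rkhs_norm K X f \<le> L"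
  unfolding rkhs_norm_def
proof (rule cInf_lower)
  show "bdd_below {L. \<exists>c. rkhs_approx K X f c \<and> (\<lambda>n. N (c n)) \<longlonglongrightarrow> L}"
    using rkhs_approx_norm_limit_nonneg by (intro bdd_belowI[of _ 0]) blast
qed (use assms in auto)

lemma rkhs_norm_nonneg: "f \<in> rkhs K X \<Longrightarrow> 0 \<le> rkhs_norm K X f"
  by (erule rkhs_norm_greatest) (rule rkhs_approx_norm_limit_nonneg)

lemma rkhs_abs_pairing_le:
  assumes f: "f \<in> rkhs K X" and d: "d \<in> V"
  shows "\<bar>pairing d f\<bar> \<le> rkhs_norm K X f * N d"
proof (cases "N d = 0")
  case True
  obtain c where c: "rkhs_approx K X f c" using f by (auto simp: rkhs_def)
  then obtain L where "(\<lambda>n. N (c n)) \<longlonglongrightarrow> L" by (rule rkhs_approx_norm_convergent)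
  thus ?thesis using rkhs_approx_abs_pairing_le[OF c _ d] True by auto
next
  case False
  hence pos: "N d > 0" using kspan_norm_nonneg[OF d] by simp
  have "\<bar>pairing d f\<bar> / N d \<le> rkhs_norm K X f"
    by (rule rkhs_norm_greatest[OF f])
      (use rkhs_approx_abs_pairing_le[OF _ _ d] pos in \<open>auto simp: divide_le_eq\<close>)
  thus ?thesis using pos by (simp add: divide_le_eq)
qed

text \<open>The Riesz representation theorem without completeness: any \<open>c\<close> that minimises
  \<open>(N c)\<^sup>2 - 2 * pairing c f\<close> up to \<open>\<delta>\<^sup>2\<close> satisfies the Euler-Lagrange equation up to \<open>\<delta>\<close>.\<close>

lemma near_representer:
  assumes bound: "\<And>d. d \<in> V \<Longrightarrow> pairing d f \<le> M * N d" and \<delta>: "\<delta> > 0"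
  obtains c where "c \<in> V" "\<And>d. d \<in> V \<Longrightarrow> \<bar>pairing d (fn c) - pairing d f\<bar> \<le> \<delta> * N d"
proof -
  define J where "J c = (N c)\<^sup>2 - 2 * pairing c f" for c
  define j where "j = Inf (J ` V)"
  have zero: "(\<lambda>_. 0) \<in> V" by (auto simp: fin_coeffs_def)
  have "- M\<^sup>2 \<le> J c" if "c \<in> V" for c
  proof -
    have "0 \<le> (N c)\<^sup>2 + M\<^sup>2 - 2 * (M * N c)"
      using zero_le_power2[of "N c - M"] unfolding power2_diff by (simp only: mult_ac)
    thus ?thesis using bound[OF that] unfolding J_def by linarith
  qed
  hence bdd: "bdd_below (J ` V)" by (rule bdd_belowI2)
  have "j < j + \<delta>\<^sup>2" using \<delta> by simp
  hence "\<exists>y\<in>J ` V. y < j + \<delta>\<^sup>2"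
    unfolding j_def by (subst (asm) cInf_less_iff) (use bdd zero in auto)
  then obtain c where c: "c \<in> V" "J c < j + \<delta>\<^sup>2" by blast
  have "\<bar>pairing d (fn c) - pairing d f\<bar> \<le> \<delta> * N d" if d: "d \<in> V" for d
  proof -
    have "(pairing d (fn c) - pairing d f)\<^sup>2 \<le> \<delta>\<^sup>2 * (N d)\<^sup>2"
    proof (rule quadratic_nonneg_imp_discriminant)
      fix t
      have "j \<le> J (add_scaled c t d)"
        unfolding j_def by (rule cInf_lower) (use c d bdd in \<open>auto intro: add_scaled_fin_coeffs\<close>)
      also have "\<dots> = J c + 2 * t * (pairing d (fn c) - pairing d f) + t\<^sup>2 * (N d)\<^sup>2"
        using c d by (simp add: J_def kspan_norm_add_scaled pairing_add_scaled_left algebra_simps)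
      finally show "0 \<le> \<delta>\<^sup>2 + 2 * t * (pairing d (fn c) - pairing d f) + t\<^sup>2 * (N d)\<^sup>2"
        using c(2) by linarith
    qed simp
    thus ?thesis using \<delta> kspan_norm_nonneg[OF d]
      by (simp add: abs_le_square_iff[symmetric] flip: power_mult_distrib)
  qed
  with c(1) that show thesis by blast
qed

lemma kspan_norm_diff_near_representers_le:
  assumes c: "c \<in> V" "c' \<in> V" and nonneg: "0 \<le> \<delta>" "0 \<le> \<delta>'"
    and near: "\<And>d. d \<in> V \<Longrightarrow> \<bar>pairing d (fn c) - pairing d f\<bar> \<le> \<delta> * N d"
      "\<And>d. d \<in> V \<Longrightarrow> \<bar>pairing d (fn c') - pairing d f\<bar> \<le> \<delta>' * N d"
  shows "N (c - c') \<le> \<delta> + \<delta>'"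
proof (cases "N (c - c') = 0")
  case False
  define d where "d = c - c'"
  have d: "d \<in> V" unfolding d_def diff_eq_add_scaled by (intro add_scaled_fin_coeffs c)
  have pos: "N d > 0" using False kspan_norm_nonneg[OF d] by (simp add: d_def)
  have "(N d)\<^sup>2 = pairing d (fn c) - pairing d (fn c')"
    unfolding pairing_self[OF d, symmetric]
    unfolding d_def diff_eq_add_scaled kspan_fun_add_scaled[OF c, abs_def]
    by (simp only: pairing_add_scaled_right)
  also have "\<dots> \<le> (\<delta> + \<delta>') * N d"
    using near[OF d] unfolding distrib_right by linarith
  finally show ?thesis using pos by (simp add: power2_eq_square d_def)
qed (use nonneg in simp)

lemma rkhs_approx_of_near_representers:
  assumes c: "\<And>n. c n \<in> V" and \<delta>: "\<delta> \<longlonglongrightarrow> 0" "\<And>n. 0 \<le> \<delta> n"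
    and near: "\<And>n d. d \<in> V \<Longrightarrow> \<bar>pairing d (fn (c n)) - pairing d f\<bar> \<le> \<delta> n * N d"
  shows "rkhs_approx K X f c"
  unfolding rkhs_approx_def
proof (intro conjI allI ballI impI)
  fix x assume x: "x \<in> X"
  define e where "e w = (\<lambda>z. if z = x then w else 0)" for w :: complex
  have e: "e w \<in> V" "{z. e w z \<noteq> 0} = (if w = 0 then {} else {x})" for w
    using x by (auto simp: e_def fin_coeffs_def)
  have "(\<lambda>n. pairing d (fn (c n)) - pairing d f) \<longlonglongrightarrow> 0" if "d \<in> V" for d
  proof (rule Lim_null_comparison)
    show "\<forall>\<^sub>F n in sequentially. norm (pairing d (fn (c n)) - pairing d f) \<le> \<delta> n * N d"
      using near[OF that] by simp
    show "(\<lambda>n. \<delta> n * N d) \<longlonglongrightarrow> 0" by (rule tendsto_mult_left_zero[OF \<delta>(1)])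
  qed
  hence lim: "(\<lambda>n. pairing (e w) (fn (c n))) \<longlonglongrightarrow> pairing (e w) f" for w
    using e(1) LIM_zero_iff by blast
  have "pairing (e 1) g = Re (g x)" "pairing (e \<i>) g = Im (g x)" for g
    unfolding pairing_def e(2) by (simp_all add: e_def)
  with lim[of 1] lim[of \<i>] show "(\<lambda>n. fn (c n) x) \<longlonglongrightarrow> f x" by (simp add: tendsto_complex_iff)
next
  fix \<epsilon> :: real assume \<epsilon>: "\<epsilon> > 0"
  have "\<forall>\<^sub>F n in sequentially. \<delta> n < \<epsilon> / 2" using order_tendstoD(2)[OF \<delta>(1), of "\<epsilon> / 2"] \<epsilon> by simp
  then obtain M where M: "\<And>n. n \<ge> M \<Longrightarrow> \<delta> n < \<epsilon> / 2" by (auto simp: eventually_sequentially)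
  have "N (c m - c n) < \<epsilon>" if "m \<ge> M" "n \<ge> M" for m n
    using kspan_norm_diff_near_representers_le[OF c c \<delta>(2) \<delta>(2) near near, of m n]
      M[OF that(1)] M[OF that(2)]
    by linarith
  thus "\<exists>M. \<forall>m\<ge>M. \<forall>n\<ge>M. N (c m - c n) < \<epsilon>" by blast
qed (rule c)

lemma dual_bound_imp_rkhs:
  assumes bound: "\<And>d. d \<in> V \<Longrightarrow> pairing d f \<le> M * N d" and M: "0 \<le> M"
  shows "f \<in> rkhs K X" and "rkhs_norm K X f \<le> M"
proof -
  define \<delta> where "\<delta> n = 1 / real (Suc n)" for n
  have \<delta>: "\<delta> \<longlonglongrightarrow> 0" "\<delta> n > 0" for n
    unfolding \<delta>_def[abs_def] using LIMSEQ_Suc[OF lim_1_over_n] by auto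
  have "\<exists>c\<in>V. \<forall>d\<in>V. \<bar>pairing d (fn c) - pairing d f\<bar> \<le> \<delta> n * N d" for n
    using near_representer[OF bound \<delta>(2)] by metis
  then obtain c where c: "\<And>n. c n \<in> V"
    and near: "\<And>n d. d \<in> V \<Longrightarrow> \<bar>pairing d (fn (c n)) - pairing d f\<bar> \<le> \<delta> n * N d" by metis
  have approx: "rkhs_approx K X f c"
    using c \<delta>(1) less_imp_le[OF \<delta>(2)] near by (rule rkhs_approx_of_near_representers)
  thus "f \<in> rkhs K X" by (auto simp: rkhs_def)
  obtain L where L: "(\<lambda>n. N (c n)) \<longlonglongrightarrow> L" using approx by (rule rkhs_approx_norm_convergent)
  have "N (c n) \<le> M + \<delta> n" for n
  proof (cases "N (c n) = 0")
    case False
    have "N (c n) * N (c n) \<le> (M + \<delta> n) * N (c n)"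
      using near[OF c[of n], of n] bound[OF c[of n]] pairing_self[OF c[of n]]
      unfolding distrib_right power2_eq_square by linarith
    thus ?thesis using False kspan_norm_nonneg[OF c[of n]] by simp
  qed (use M \<delta>(2)[of n] in simp)
  moreover have "(\<lambda>n. M + \<delta> n) \<longlonglongrightarrow> M + 0" by (intro tendsto_intros \<delta>)
  ultimately have "L \<le> M" using L by (auto intro: LIMSEQ_le)
  thus "rkhs_norm K X f \<le> M" using rkhs_norm_le[OF approx L] by simp
qed

end

lemma rkhs_embeds_of_kspan_norm_le:
  assumes "psd_kernel X K" "psd_kernel X L" and C: "C > 0"
    and N: "\<And>d. d \<in> fin_coeffs X \<Longrightarrow> kspan_norm K d \<le> C * kspan_norm L d"
  shows "rkhs_embeds K L X"
proof -
  interpret K: psd_kernel X K by fact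
  interpret L: psd_kernel X L by fact
  have *: "f \<in> rkhs L X \<and> rkhs_norm L X f \<le> C * rkhs_norm K X f" if f: "f \<in> rkhs K X" for f
  proof -
    have "pairing d f \<le> (C * rkhs_norm K X f) * L.N d" if "d \<in> fin_coeffs X" for d
      using K.rkhs_abs_pairing_le[OF f that] mult_left_mono[OF N[OF that] K.rkhs_norm_nonneg[OF f]]
      by (simp add: algebra_simps)
    thus ?thesis
      using L.dual_bound_imp_rkhs[of f "C * rkhs_norm K X f"] K.rkhs_norm_nonneg[OF f] C by auto
  qed
  thus ?thesis using C unfolding rkhs_embeds_def by blast
qed

abbreviation real_kernel :: "('x \<Rightarrow> 'x \<Rightarrow> real) \<Rightarrow> 'x \<Rightarrow> 'x \<Rightarrow> complex" where
  "real_kernel k \<equiv> (\<lambda>x y. complex_of_real (k x y))"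

lemma pairing_real_kernel:
  assumes k: "psd_on X k" and S: "finite S" "S \<subseteq> X" "{z. d z \<noteq> 0} \<subseteq> S"
  shows "pairing d (kspan_fun (real_kernel k) d) =
    quad_form S (\<lambda>x. Re (d x)) k + quad_form S (\<lambda>x. Im (d x)) k"
proof -
  have "pairing d (kspan_fun (real_kernel k) d) =
    (\<Sum>x\<in>S. \<Sum>y\<in>S. (Re (d x) * Re (d y) + Im (d x) * Im (d y)) * k x y)"
    unfolding pairing_superset[OF S(1,3)] kspan_fun_superset[OF S(1,3)]
    by (simp add: sum_distrib_left algebra_simps flip: sum.distrib)
  thus ?thesis by (simp add: quad_form_def distrib_right sum.distrib)
qed

lemma psd_kernel_real_kernel:
  assumes "psd_on X k"
  shows "psd_kernel X (real_kernel k)"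
proof
  show "complex_of_real (k y x) = cnj (complex_of_real (k x y))" if "x \<in> X" "y \<in> X" for x y
    using psd_on_sym[OF assms that] by simp
  fix c assume "c \<in> fin_coeffs X"
  hence "finite {z. c z \<noteq> 0}" "{z. c z \<noteq> 0} \<subseteq> X" by (auto simp: fin_coeffs_def)
  thus "0 \<le> pairing c (kspan_fun (real_kernel k) c)"
    using pairing_real_kernel[OF assms _ _ order_refl] quad_form_nonneg[OF assms] by simp
qed

lemma rkhs_embeds_of_dominated_on:
  assumes kl: "dominated_on X k l"
  shows "rkhs_embeds (real_kernel k) (real_kernel l) X"
proof -
  note psd = dominated_on_psd[OF kl]
  obtain C where C: "C > 0" "form_le_on X C k l" by (rule dominated_onE[OF kl])
  show ?thesis
  proof (rule rkhs_embeds_of_kspan_norm_le[OF psd[THEN psd_kernel_real_kernel]])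
    fix d assume "d \<in> fin_coeffs X"
    hence S: "finite {z. d z \<noteq> 0}" "{z. d z \<noteq> 0} \<subseteq> X" by (auto simp: fin_coeffs_def)
    show "kspan_norm (real_kernel k) d \<le> sqrt C * kspan_norm (real_kernel l) d"
      unfolding kspan_norm_eq_sqrt_pairing psd[THEN pairing_real_kernel, OF S order_refl]
        real_sqrt_mult[symmetric] distrib_left
      by (intro real_sqrt_le_mono add_mono form_le_onD[OF C(2)] S)
  qed (use C in simp)
qed

lemma real_fun_in_rkhs_iff:
  assumes k: "psd_on X k"
  shows "(\<lambda>x. complex_of_real (f x)) \<in> rkhs (real_kernel k) X \<longleftrightarrow> dominated_on X (rank1 f) k"
    (is "?f \<in> rkhs ?K X \<longleftrightarrow> ?dominated")
proof
  interpret psd_kernel X ?K by (rule psd_kernel_real_kernel[OF k])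
  assume f: "?f \<in> rkhs ?K X"
  show ?dominated
  proof (rule dominated_onI)
    fix S and c :: "'a \<Rightarrow> real" assume S: "finite S" "S \<subseteq> X"
    define d where "d x = (if x \<in> S then complex_of_real (c x) else 0)" for x
    have supp: "{x. d x \<noteq> 0} \<subseteq> S" by (auto simp: d_def)
    hence d: "d \<in> V" using S finite_subset by (auto simp: fin_coeffs_def)
    have "quad_form S (\<lambda>x. Re (d x)) k = quad_form S c k" "quad_form S (\<lambda>x. Im (d x)) k = 0"
      unfolding quad_form_def d_def by auto
    hence "N d = sqrt (quad_form S c k)"
      unfolding kspan_norm_eq_sqrt_pairing pairing_real_kernel[OF k S supp] by simp
    moreover have "pairing d ?f = weighted_sum S c f"
      by (simp add: pairing_superset[OF S(1) supp] d_def weighted_sum_def)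
    ultimately have "\<bar>weighted_sum S c f\<bar> \<le> rkhs_norm ?K X ?f * sqrt (quad_form S c k)"
      using rkhs_abs_pairing_le[OF f d] by simp
    hence "\<bar>weighted_sum S c f\<bar>\<^sup>2 \<le> (rkhs_norm ?K X ?f * sqrt (quad_form S c k))\<^sup>2"
      by (rule power_mono) simp
    thus "quad_form S c (rank1 f) \<le> (rkhs_norm ?K X ?f)\<^sup>2 * quad_form S c k"
      using quad_form_nonneg[OF k S] by (simp add: quad_form_rank1 power_mult_distrib)
  qed (simp_all add: k psd_on_rank1)
next
  interpret psd_kernel X ?K by (rule psd_kernel_real_kernel[OF k])
  assume ?dominated
  then obtain C where C: "C > 0" "\<And>S c. finite S \<Longrightarrow> S \<subseteq> X \<Longrightarrow> (weighted_sum S c f)\<^sup>2 \<le> C * quad_form S c k"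
    unfolding dominated_on_def form_le_on_def quad_form_rank1 by blast
  show "?f \<in> rkhs ?K X"
  proof (rule dual_bound_imp_rkhs)
    fix d assume d: "d \<in> V"
    let ?S = "{x. d x \<noteq> 0}"
    have S: "finite ?S" "?S \<subseteq> X" using d by (auto simp: fin_coeffs_def)
    have "(pairing d ?f)\<^sup>2 = (weighted_sum ?S (\<lambda>x. Re (d x)) f)\<^sup>2"
      by (simp add: pairing_def weighted_sum_def)
    also have "\<dots> \<le> C * quad_form ?S (\<lambda>x. Re (d x)) k" by (rule C(2)[OF S])
    also have "\<dots> \<le> C * (N d)\<^sup>2"
      unfolding pairing_self[OF d, symmetric] pairing_real_kernel[OF k S order_refl]
      using C(1) quad_form_nonneg[OF k S] by simp
    finally have "sqrt ((pairing d ?f)\<^sup>2) \<le> sqrt (C * (N d)\<^sup>2)" by (rule real_sqrt_le_mono)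
    thus "pairing d ?f \<le> sqrt C * N d" using kspan_norm_nonneg[OF d] by (simp add: real_sqrt_mult)
  qed (use C in simp)
qed

section \<open>Bounded measurable functions on the unit interval\<close>

abbreviation lborel01 :: "real measure" where "lborel01 \<equiv> restrict_space lborel {0..1}"

lemma finite_measure_lborel01: "finite_measure lborel01"
  by (rule finite_measureI) (simp add: emeasure_restrict_space)

lemma measure_lborel01 [simp]: "measure lborel01 {0..1} = 1"
  by (simp add: measure_restrict_space)

definition bounded_measurable :: "(real \<Rightarrow> real) \<Rightarrow> bool" where
  "bounded_measurable f \<longleftrightarrow> f \<in> borel_measurable lborel01 \<and> (\<exists>B. \<forall>t\<in>{0..1}. \<bar>f t\<bar> \<le> B)"

named_theorems bounded_measurable_intros

lemma bounded_measurable_integrable: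
  assumes "bounded_measurable f"
  shows "integrable lborel01 f"
proof -
  obtain B where "\<forall>t\<in>{0..1}. \<bar>f t\<bar> \<le> B" using assms by (auto simp: bounded_measurable_def)
  thus ?thesis using assms
    by (intro finite_measure.integrable_const_bound[OF finite_measure_lborel01, of _ B])
       (auto simp: bounded_measurable_def space_restrict_space intro!: AE_I2)
qed

lemma bounded_measurable_const [bounded_measurable_intros]: "bounded_measurable (\<lambda>_. c)"
  by (auto simp: bounded_measurable_def)

lemma bounded_measurable_add [bounded_measurable_intros]:
  assumes "bounded_measurable f" "bounded_measurable g"
  shows "bounded_measurable (\<lambda>t. f t + g t)"
proof -
  obtain B C where "\<forall>t\<in>{0..1}. \<bar>f t\<bar> \<le> B" "\<forall>t\<in>{0..1}. \<bar>g t\<bar> \<le> C"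
    using assms by (auto simp: bounded_measurable_def)
  hence "\<forall>t\<in>{0..1}. \<bar>f t + g t\<bar> \<le> B + C" by (smt (verit))
  thus ?thesis using assms by (auto simp: bounded_measurable_def intro!: borel_measurable_add)
qed

lemma bounded_measurable_mult [bounded_measurable_intros]:
  assumes "bounded_measurable f" "bounded_measurable g"
  shows "bounded_measurable (\<lambda>t. f t * g t)"
proof -
  obtain B C where "\<forall>t\<in>{0..1}. \<bar>f t\<bar> \<le> B" "\<forall>t\<in>{0..1}. \<bar>g t\<bar> \<le> C"
    using assms by (auto simp: bounded_measurable_def)
  hence "\<forall>t\<in>{0..1}. \<bar>f t * g t\<bar> \<le> B * C" unfolding abs_mult by (smt (verit) mult_mono abs_ge_zero)
  thus ?thesis using assms by (auto simp: bounded_measurable_def intro!: borel_measurable_times)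
qed

lemma bounded_measurable_uminus [bounded_measurable_intros]:
  "bounded_measurable f \<Longrightarrow> bounded_measurable (\<lambda>t. - f t)"
  using bounded_measurable_mult[OF bounded_measurable_const[of "-1"]] by simp

lemma bounded_measurable_diff [bounded_measurable_intros]:
  "bounded_measurable f \<Longrightarrow> bounded_measurable g \<Longrightarrow> bounded_measurable (\<lambda>t. f t - g t)"
  using bounded_measurable_add[OF _ bounded_measurable_uminus, of f g] by simp

lemma bounded_measurable_sum [bounded_measurable_intros]:
  "(\<And>i. i \<in> I \<Longrightarrow> bounded_measurable (f i)) \<Longrightarrow> bounded_measurable (\<lambda>t. \<Sum>i\<in>I. f i t)"
  by (induction I rule: infinite_finite_induct) (auto intro: bounded_measurable_intros)

lemma bounded_measurable_power2 [bounded_measurable_intros]: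
  "bounded_measurable f \<Longrightarrow> bounded_measurable (\<lambda>t. (f t)\<^sup>2)"
  unfolding power2_eq_square by (rule bounded_measurable_mult)

lemma bounded_measurable_continuous:
  assumes "continuous_on UNIV f"
  shows "bounded_measurable f"
proof -
  have "compact (f ` {0..1})"
    by (intro compact_continuous_image continuous_on_subset[OF assms]) auto
  hence "bounded (f ` {0..1})" by (rule compact_imp_bounded)
  then obtain B where "\<forall>t\<in>{0..1}. \<bar>f t\<bar> \<le> B" by (auto simp: bounded_iff)
  thus ?thesis using borel_measurable_continuous_onI[OF assms]
    by (auto simp: bounded_measurable_def intro!: measurable_restrict_space1)
qed

lemma bounded_measurable_cos [bounded_measurable_intros]: "bounded_measurable (\<lambda>t. cos (\<omega> * t + \<theta>))"
  by (intro bounded_measurable_continuous continuous_intros)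

lemma bounded_measurable_If_le:
  assumes "bounded_measurable f" "bounded_measurable g"
  shows "bounded_measurable (\<lambda>t. if t \<le> x then f t else g t)"
proof -
  obtain B C where "\<forall>t\<in>{0..1}. \<bar>f t\<bar> \<le> B" "\<forall>t\<in>{0..1}. \<bar>g t\<bar> \<le> C"
    using assms by (auto simp: bounded_measurable_def)
  hence "\<forall>t\<in>{0..1}. \<bar>if t \<le> x then f t else g t\<bar> \<le> max B C" by (smt (verit))
  moreover have "(\<lambda>t. if t \<le> x then f t else g t) \<in> borel_measurable lborel01"
  proof (rule measurable_If)
    have "{t \<in> space lborel01. t \<le> x} = {0..1} \<inter> {..x}" by auto
    thus "{t \<in> space lborel01. t \<le> x} \<in> sets lborel01" by (auto simp: sets_restrict_space)
  qed (use assms in \<open>auto simp: bounded_measurable_def\<close>)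
  ultimately show ?thesis unfolding bounded_measurable_def by blast
qed

lemmas integral_bounded_measurable =
  Bochner_Integration.integral_add[OF bounded_measurable_integrable bounded_measurable_integrable]
  Bochner_Integration.integral_diff[OF bounded_measurable_integrable bounded_measurable_integrable]
  Bochner_Integration.integral_sum[OF bounded_measurable_integrable]

lemma has_integral_imp_integral_lborel01:
  assumes "bounded_measurable f" "(f has_integral i) {0..1}"
  shows "integral\<^sup>L lborel01 f = i"
proof -
  have "set_integrable lborel {0..1} f"
    using bounded_measurable_integrable[OF assms(1)] unfolding set_integrable_def
    by (subst (asm) integrable_restrict_space) auto
  hence "set_lebesgue_integral lborel {0..1} f = integral {0..1} f"
    by (rule set_borel_integral_eq_integral)
  thus ?thesis using assms(2)
    by (simp add: integral_restrict_space set_lebesgue_integral_def integral_unique)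
qed

lemma integral_lborel01_FTC:
  assumes "finite S" "continuous_on {0..1} F"
    "\<And>t. t \<in> {0..1} - S \<Longrightarrow> (F has_real_derivative f t) (at t)" "bounded_measurable f"
  shows "integral\<^sup>L lborel01 f = F 1 - F 0"
  by (rule has_integral_imp_integral_lborel01[OF assms(4)],
    rule fundamental_theorem_of_calculus_strong[of S])
     (use assms in \<open>auto simp: has_real_derivative_iff_has_vector_derivative[symmetric]\<close>)

lemma continuous_nonneg_integral_eq_0:
  fixes f :: "real \<Rightarrow> real"
  assumes f: "continuous_on UNIV f" and nonneg: "\<And>t. t \<in> {0..1} \<Longrightarrow> 0 \<le> f t"
    and "integral\<^sup>L lborel01 f = 0" and x: "x \<in> {0..1}"
  shows "f x = 0"
proof -
  have "(f has_integral integral {0..1} f) {0..1}"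
    by (intro integrable_integral integrable_continuous_real continuous_on_subset[OF f]) auto
  moreover from this have "integral {0..1} f = integral\<^sup>L lborel01 f"
    by (intro has_integral_imp_integral_lborel01[symmetric] bounded_measurable_continuous f)
  ultimately have "(f has_integral 0) (cbox 0 1)" using assms(3) by (simp add: cbox_interval)
  thus ?thesis
    using x nonneg by (intro has_integral_0_cbox_imp_0[of 0 1 f x] continuous_on_subset[OF f]) auto
qed

lemma Cauchy_Schwarz_sum_integral:
  assumes V: "bounded_measurable V" and F: "bounded_measurable F"
  shows "((\<Sum>i\<in>I. b i * m i) + (\<integral>t. V t * F t \<partial>lborel01))\<^sup>2 \<le>
    ((\<Sum>i\<in>I. (b i)\<^sup>2) + (\<integral>t. (V t)\<^sup>2 \<partial>lborel01)) * ((\<Sum>i\<in>I. (m i)\<^sup>2) + (\<integral>t. (F t)\<^sup>2 \<partial>lborel01))"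
proof (rule quadratic_nonneg_imp_discriminant)
  fix u :: real
  have "(\<integral>t. (V t + u * F t)\<^sup>2 \<partial>lborel01) =
      (\<integral>t. (V t)\<^sup>2 + 2 * u * (V t * F t) + u\<^sup>2 * (F t)\<^sup>2 \<partial>lborel01)"
    by (simp add: power2_sum power_mult_distrib algebra_simps)
  also have "\<dots> =
      (\<integral>t. (V t)\<^sup>2 \<partial>lborel01) + 2 * u * (\<integral>t. V t * F t \<partial>lborel01) + u\<^sup>2 * (\<integral>t. (F t)\<^sup>2 \<partial>lborel01)"
    by (simp add: integral_bounded_measurable bounded_measurable_intros V F)
  finally have int: "(\<integral>t. (V t + u * F t)\<^sup>2 \<partial>lborel01) =
    (\<integral>t. (V t)\<^sup>2 \<partial>lborel01) + 2 * u * (\<integral>t. V t * F t \<partial>lborel01) + u\<^sup>2 * (\<integral>t. (F t)\<^sup>2 \<partial>lborel01)" .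
  have "0 \<le> (\<Sum>i\<in>I. (b i + u * m i)\<^sup>2) + (\<integral>t. (V t + u * F t)\<^sup>2 \<partial>lborel01)" by (simp add: sum_nonneg)
  also have "(\<Sum>i\<in>I. (b i + u * m i)\<^sup>2) =
      (\<Sum>i\<in>I. (b i)\<^sup>2) + 2 * u * (\<Sum>i\<in>I. b i * m i) + u\<^sup>2 * (\<Sum>i\<in>I. (m i)\<^sup>2)"
    by (simp add: power2_sum power_mult_distrib sum.distrib sum_distrib_left mult_ac)
  finally show "0 \<le> ((\<Sum>i\<in>I. (b i)\<^sup>2) + (\<integral>t. (V t)\<^sup>2 \<partial>lborel01))
      + 2 * u * ((\<Sum>i\<in>I. b i * m i) + (\<integral>t. V t * F t \<partial>lborel01))
      + u\<^sup>2 * ((\<Sum>i\<in>I. (m i)\<^sup>2) + (\<integral>t. (F t)\<^sup>2 \<partial>lborel01))"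
    unfolding int by (simp add: algebra_simps)
qed (simp add: sum_nonneg)

lemma power2_integral_le:
  assumes "bounded_measurable F"
  shows "(integral\<^sup>L lborel01 F)\<^sup>2 \<le> (\<integral>t. (F t)\<^sup>2 \<partial>lborel01)"
  using Cauchy_Schwarz_sum_integral[OF bounded_measurable_const[of 1] assms, where I = "{}"] by simp

section \<open>Bernoulli polynomials and the Euler-Maclaurin formula\<close>

declare bernoulli_num.simps [simp del]

definition bernoulli_scaled :: "nat \<Rightarrow> real \<Rightarrow> real" where
  "bernoulli_scaled n x = bernoulli_poly n x / fact n"

lemma bernoulli_scaled_altdef:
  "bernoulli_scaled n x = (\<Sum>k\<le>n. bernoulli_num k / fact k * (x ^ (n - k) / fact (n - k)))"
  unfolding bernoulli_scaled_def bernoulli_poly_def sum_divide_distrib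
  by (intro sum.cong refl) (simp add: binomial_fact field_simps)

lemma bernoulli_num_0: "bernoulli_num 0 = 1"
  by (simp add: bernoulli_num.simps)

lemma bernoulli_num_1: "bernoulli_num (Suc 0) = - 1 / 2"
  by (subst bernoulli_num.simps) (simp add: bernoulli_num_0)

lemma bernoulli_num_2: "bernoulli_num 2 = 1 / 6"
  by (subst bernoulli_num.simps)
     (simp add: numeral_2_eq_2 bernoulli_num_0 bernoulli_num_1)

lemma bernoulli_scaled_0 [simp]: "bernoulli_scaled 0 x = 1"
  by (simp add: bernoulli_scaled_altdef bernoulli_num_0)

lemma bernoulli_scaled_1: "bernoulli_scaled (Suc 0) x = x - 1 / 2"
  by (simp add: bernoulli_scaled_altdef bernoulli_num_0 bernoulli_num_1)

lemma bernoulli_scaled_2: "bernoulli_scaled 2 x = x\<^sup>2 / 2 - x / 2 + 1 / 12"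
  using bernoulli_num_2
  by (simp add: bernoulli_scaled_altdef numeral_2_eq_2 atMost_Suc bernoulli_num_0 bernoulli_num_1)

lemma DERIV_bernoulli_scaled [derivative_intros]:
  assumes "(g has_real_derivative g') (at t within A)"
  shows "((\<lambda>t. bernoulli_scaled (Suc n) (g t)) has_real_derivative
    bernoulli_scaled n (g t) * g') (at t within A)"
proof -
  have "((\<lambda>x. bernoulli_num k / fact k * (x ^ (Suc n - k) / fact (Suc n - k))) has_real_derivative
      bernoulli_num k / fact k * (y ^ (n - k) / fact (n - k))) (at y)" if "k \<le> n" for k y
  proof -
    have "real (Suc m) * y ^ (Suc m - Suc 0) / fact (Suc m) = y ^ m / fact m" for m
      by (simp add: divide_simps)
    thus ?thesis
      using DERIV_cmult[OF DERIV_cdivide[OF DERIV_pow[of "Suc (n - k)" y UNIV]],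
          of "bernoulli_num k / fact k" "fact (Suc (n - k))"]
      by (simp only: Suc_diff_le[OF that])
  qed
  hence "((\<lambda>x. (\<Sum>k\<le>n. bernoulli_num k / fact k * (x ^ (Suc n - k) / fact (Suc n - k)))
      + bernoulli_num (Suc n) / fact (Suc n))
     has_real_derivative bernoulli_scaled n (g t) + 0) (at (g t))"
    unfolding bernoulli_scaled_altdef by (intro DERIV_add DERIV_sum DERIV_const) auto
  hence "(bernoulli_scaled (Suc n) has_real_derivative bernoulli_scaled n (g t)) (at (g t))"
    by (simp add: bernoulli_scaled_altdef[abs_def])
  thus ?thesis using assms by (rule DERIV_chain2)
qed

lemma continuous_on_bernoulli_scaled [continuous_intros]:
  "continuous_on A g \<Longrightarrow> continuous_on A (\<lambda>t. bernoulli_scaled n (g t))"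
  unfolding bernoulli_scaled_altdef by (intro continuous_intros) auto

lemma bernoulli_scaled_jump:
  "bernoulli_scaled (Suc n) 1 - bernoulli_scaled (Suc n) 0 = (if n = 0 then 1 else 0)"
proof (cases "n = 0")
  case False
  have "real (Suc n) * bernoulli_num n = - (\<Sum>k<n. real (Suc n choose k) * bernoulli_num k)"
    using False by (subst bernoulli_num.simps) (simp add: field_simps)
  hence "(\<Sum>k\<le>n. real (Suc n choose k) * bernoulli_num k) = 0"
    by (simp add: lessThan_Suc_atMost[symmetric])
  hence "bernoulli_poly (Suc n) 1 = bernoulli_num (Suc n)"
    by (simp add: bernoulli_poly_def)
  moreover have "bernoulli_poly (Suc n) 0 = (\<Sum>k\<le>Suc n. if k = Suc n then bernoulli_num (Suc n) else 0)"
    unfolding bernoulli_poly_def by (intro sum.cong refl) (auto simp: power_0_left)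
  ultimately show ?thesis using False by (simp add: bernoulli_scaled_def)
qed (simp add: bernoulli_scaled_1)

text \<open>As a function of \<open>t\<close> this is \<open>B\<^sub>n({x - t}) / n!\<close> on the unit interval.\<close>

definition bernoulli_periodic :: "nat \<Rightarrow> real \<Rightarrow> real \<Rightarrow> real" where
  "bernoulli_periodic n x t =
    (if t \<le> x then bernoulli_scaled n (x - t) else bernoulli_scaled n (x - t + 1))"

lemma bernoulli_periodic_0: "bernoulli_periodic 0 x = (\<lambda>_. 1)"
  by (simp add: bernoulli_periodic_def fun_eq_iff)

lemma bounded_measurable_bernoulli_periodic [bounded_measurable_intros]:
  "bounded_measurable (bernoulli_periodic n x)"
  unfolding bernoulli_periodic_def
  by (intro bounded_measurable_If_le bounded_measurable_continuous continuous_intros)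

lemma DERIV_if_le:
  fixes f g :: "real \<Rightarrow> real"
  assumes "t < x \<Longrightarrow> (f has_real_derivative d) (at t)" "x < t \<Longrightarrow> (g has_real_derivative d) (at t)" "t \<noteq> x"
  shows "((\<lambda>t. if t \<le> x then f t else g t) has_real_derivative d) (at t)"
proof (cases "t < x")
  case True
  thus ?thesis
    by (intro has_field_derivative_transform_within_open[OF assms(1), of "{..<x}"]) auto
next
  case False
  thus ?thesis
    by (intro has_field_derivative_transform_within_open[OF assms(2), of "{x<..}"])
      (use assms(3) in auto)
qed

lemma continuous_on_if_le:
  fixes f g :: "real \<Rightarrow> real"
  assumes "closed A" "continuous_on A f" "continuous_on A g" "f x = g x"
  shows "continuous_on A (\<lambda>t. if t \<le> x then f t else g t)"
proof -
  have "continuous_on ((A \<inter> {..x}) \<union> (A \<inter> {x..})) (\<lambda>t. if t \<le> x then f t else g t)"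
    using assms by (intro continuous_on_If closed_Int) (auto intro: continuous_on_subset)
  moreover have "(A \<inter> {..x}) \<union> (A \<inter> {x..}) = A" by auto
  ultimately show ?thesis by simp
qed

lemma DERIV_bernoulli_periodic:
  "t \<noteq> x \<Longrightarrow> (bernoulli_periodic (Suc n) x has_real_derivative - bernoulli_periodic n x t) (at t)"
  unfolding bernoulli_periodic_def[abs_def] by (rule DERIV_if_le) (auto intro!: derivative_eq_intros)

lemma continuous_on_bernoulli_periodic:
  assumes "1 \<le> n"
  shows "continuous_on A (bernoulli_periodic (Suc n) x)"
proof -
  have "continuous_on UNIV (bernoulli_periodic (Suc n) x)"
    unfolding bernoulli_periodic_def[abs_def]
    by (rule continuous_on_if_le)
      (use bernoulli_scaled_jump[of n] assms in \<open>auto intro!: continuous_intros\<close>)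
  thus ?thesis by (rule continuous_on_subset) simp
qed

lemma bernoulli_periodic_ends:
  assumes "1 \<le> n" "x \<in> {0..1}"
  shows "bernoulli_periodic (Suc n) x 0 = bernoulli_scaled (Suc n) x"
    "bernoulli_periodic (Suc n) x 1 = bernoulli_scaled (Suc n) x"
  using assms bernoulli_scaled_jump[of n] by (auto simp: bernoulli_periodic_def)

text \<open>The jump of \<open>bernoulli_periodic 1 x\<close> at \<open>x\<close> produces the value \<open>\<phi> x\<close> when \<open>n = 0\<close>.\<close>

lemma integral_bernoulli_periodic_by_parts:
  assumes x: "x \<in> {0..1}" and S: "finite S" and \<phi>: "continuous_on {0..1} \<phi>"
    and deriv: "\<And>t. t \<in> {0..1} - S \<Longrightarrow> (\<phi> has_real_derivative \<phi>' t) (at t)"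
    and [bounded_measurable_intros]: "bounded_measurable \<phi>" "bounded_measurable \<phi>'"
  shows "(\<integral>t. bernoulli_periodic (Suc n) x t * \<phi>' t \<partial>lborel01) =
    (\<integral>t. bernoulli_periodic n x t * \<phi> t \<partial>lborel01) + bernoulli_scaled (Suc n) x * (\<phi> 1 - \<phi> 0)
      - (if n = 0 then \<phi> x else 0)"
proof -
  define J :: real where "J = (if n = 0 then 1 else 0)"
  have jump: "bernoulli_scaled (Suc n) 1 = bernoulli_scaled (Suc n) 0 + J"
    using bernoulli_scaled_jump[of n] by (simp add: J_def)
  define G where "G t = (if t \<le> x then bernoulli_scaled (Suc n) (x - t) * \<phi> t
    else bernoulli_scaled (Suc n) (x - t + 1) * \<phi> t - J * \<phi> x)" for t
  have "(\<integral>t. bernoulli_periodic (Suc n) x t * \<phi>' t - bernoulli_periodic n x t * \<phi> t \<partial>lborel01) =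
      G 1 - G 0"
  proof (rule integral_lborel01_FTC[of "insert x S"])
    show "continuous_on {0..1} G"
      unfolding G_def by (intro continuous_on_if_le continuous_intros \<phi>) (simp add: jump algebra_simps)
    fix t assume t: "t \<in> {0..1} - insert x S"
    hence \<phi>t: "(\<phi> has_real_derivative \<phi>' t) (at t)" by (intro deriv) auto
    show "(G has_real_derivative bernoulli_periodic (Suc n) x t * \<phi>' t - bernoulli_periodic n x t * \<phi> t) (at t)"
      unfolding G_def[abs_def]
      by (rule DERIV_if_le)
        (use t in \<open>auto intro!: derivative_eq_intros \<phi>t simp: bernoulli_periodic_def\<close>)
  qed (use S in \<open>auto intro!: bounded_measurable_intros\<close>)
  moreover have "(\<integral>t. bernoulli_periodic (Suc n) x t * \<phi>' t - bernoulli_periodic n x t * \<phi> t \<partial>lborel01) =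
      (\<integral>t. bernoulli_periodic (Suc n) x t * \<phi>' t \<partial>lborel01)
        - (\<integral>t. bernoulli_periodic n x t * \<phi> t \<partial>lborel01)"
    by (intro integral_bounded_measurable bounded_measurable_intros)
  moreover have "G 1 - G 0 = bernoulli_scaled (Suc n) x * (\<phi> 1 - \<phi> 0) - J * \<phi> x"
    using x jump by (cases "x = 1") (auto simp: G_def algebra_simps)
  ultimately show ?thesis by (cases "n = 0") (auto simp: J_def)
qed

lemma integral_bernoulli_periodic:
  assumes "1 \<le> n" "x \<in> {0..1}"
  shows "integral\<^sup>L lborel01 (bernoulli_periodic n x) = 0"
  using integral_bernoulli_periodic_by_parts[OF assms(2), of "{}" "\<lambda>_. 1" "\<lambda>_. 0" n] assms(1)
  by (simp add: bounded_measurable_intros)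

lemma integral_bernoulli_periodic_mult_Suc:
  assumes x: "x \<in> {0..1}" and y: "y \<in> {0..1}" and m: "1 \<le> m"
  shows "(\<integral>t. bernoulli_periodic m x t * bernoulli_periodic (Suc n) y t \<partial>lborel01) =
    (-1) ^ n * bernoulli_periodic (m + Suc n) x y"
  using m
proof (induction n arbitrary: m)
  case 0
  have "(\<integral>t. bernoulli_periodic (Suc 0) y t * (- bernoulli_periodic m x t) \<partial>lborel01) =
    (\<integral>t. bernoulli_periodic 0 y t * bernoulli_periodic (Suc m) x t \<partial>lborel01)
      + bernoulli_scaled (Suc 0) y * (bernoulli_periodic (Suc m) x 1 - bernoulli_periodic (Suc m) x 0)
      - (if 0 = (0::nat) then bernoulli_periodic (Suc m) x y else 0)"
    by (rule integral_bernoulli_periodic_by_parts[OF y, of "{x}"])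
       (use 0 in \<open>auto intro!: continuous_on_bernoulli_periodic DERIV_bernoulli_periodic
         bounded_measurable_intros\<close>)
  also note bernoulli_periodic_0
  finally show ?case
    using integral_bernoulli_periodic[of "Suc m" x] bernoulli_periodic_ends[OF 0 x] x
    by (simp add: mult.commute)
next
  case (Suc n)
  have "(\<integral>t. bernoulli_periodic (Suc m) x t * (- bernoulli_periodic (Suc n) y t) \<partial>lborel01) =
     (\<integral>t. bernoulli_periodic m x t * bernoulli_periodic (Suc (Suc n)) y t \<partial>lborel01)
       + bernoulli_scaled (Suc m) x *
         (bernoulli_periodic (Suc (Suc n)) y 1 - bernoulli_periodic (Suc (Suc n)) y 0)
       - (if m = 0 then bernoulli_periodic (Suc (Suc n)) y x else 0)"
    by (rule integral_bernoulli_periodic_by_parts[OF x, of "{y}"])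
       (auto intro!: continuous_on_bernoulli_periodic DERIV_bernoulli_periodic bounded_measurable_intros)
  thus ?case using Suc.IH[of "Suc m"] Suc.prems bernoulli_periodic_ends[OF _ y, of "Suc n"] by simp
qed

lemma integral_bernoulli_periodic_mult:
  assumes "x \<in> {0..1}" "y \<in> {0..1}" "1 \<le> a"
  shows "(\<integral>t. bernoulli_periodic a x t * bernoulli_periodic a y t \<partial>lborel01) =
    - ((-1) ^ a * bernoulli_scaled (2 * a) \<bar>x - y\<bar>)"
proof -
  obtain n where n: "a = Suc n" using assms(3) by (cases a) auto
  have "(\<integral>t. bernoulli_periodic a x t * bernoulli_periodic a y t \<partial>lborel01) =
    - ((-1) ^ a * bernoulli_scaled (2 * a) (x - y))" if "x \<in> {0..1}" "y \<in> {0..1}" "y \<le> x" for x y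
    using integral_bernoulli_periodic_mult_Suc[OF that(1,2) assms(3), of n] that(3)
    by (simp add: n bernoulli_periodic_def mult_2)
  from this[of x y] this[of y x] show ?thesis
    using assms by (cases "y \<le> x") (auto simp: mult.commute)
qed

lemma Euler_Maclaurin:
  fixes F :: "nat \<Rightarrow> real \<Rightarrow> real"
  assumes F: "\<And>k t. (F k has_real_derivative F (Suc k) t) (at t)" and x: "x \<in> {0..1}" and a: "1 \<le> a"
  shows "F 0 x = integral\<^sup>L lborel01 (F 0)
    + (\<Sum>\<tau>=1..a. bernoulli_scaled \<tau> x * integral\<^sup>L lborel01 (F \<tau>))
    - (\<integral>t. bernoulli_periodic a x t * F a t \<partial>lborel01)"
proof -
  have cont: "continuous_on A (F k)" for k A
    by (rule DERIV_continuous_on) (rule has_field_derivative_at_within[OF F])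
  have by_parts: "(\<integral>t. bernoulli_periodic (Suc n) x t * F (Suc n) t \<partial>lborel01) =
      (\<integral>t. bernoulli_periodic n x t * F n t \<partial>lborel01)
        + bernoulli_scaled (Suc n) x * integral\<^sup>L lborel01 (F (Suc n))
        - (if n = 0 then F 0 x else 0)" for n
    using integral_bernoulli_periodic_by_parts[OF x, of "{}" "F n" "F (Suc n)" n]
      integral_lborel01_FTC[of "{}" "F n" "F (Suc n)"]
    by (auto simp: F cont bounded_measurable_continuous)
  show ?thesis
    using a
  proof (induction a rule: dec_induct)
    case base
    show ?case using by_parts[of 0] by (simp add: bernoulli_periodic_0)
  next
    case (step n)
    thus ?case using by_parts[of n] by simp
  qed
qed

section \<open>The one-dimensional kernels\<close>

text \<open>Index \<open>n\<close> stands for the frequency \<open>n + 1\<close>.\<close>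

definition decay :: "real \<Rightarrow> nat \<Rightarrow> real" where
  "decay \<alpha> n = real (Suc n) powr (- 2 * \<alpha>)"

definition decay_series :: "real \<Rightarrow> (nat \<Rightarrow> 'a \<Rightarrow> 'a \<Rightarrow> real) \<Rightarrow> 'a \<Rightarrow> 'a \<Rightarrow> real" where
  "decay_series \<alpha> p x y = (\<Sum>n. decay \<alpha> n * p n x y)"

definition kor_term :: "nat \<Rightarrow> real \<Rightarrow> real \<Rightarrow> real" where
  "kor_term n x y = 2 * cos (2 * pi * real (Suc n) * (x - y))"

definition cos_term :: "nat \<Rightarrow> real \<Rightarrow> real \<Rightarrow> real" where
  "cos_term n x y = 2 * (cos (pi * real (Suc n) * x) * cos (pi * real (Suc n) * y))"

abbreviation "kor_core \<alpha> \<equiv> decay_series \<alpha> kor_term"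
abbreviation "cos_core \<alpha> \<equiv> decay_series \<alpha> cos_term"
abbreviation "korcos_core \<alpha> \<equiv> (\<lambda>x y. (1 / 2) * kor_core \<alpha> x y + (1 / 2) * cos_core \<alpha> x y)"

definition sob_core :: "nat \<Rightarrow> real \<Rightarrow> real \<Rightarrow> real" where
  "sob_core a x y =
    (\<Sum>\<tau>=1..a. bernoulli_scaled \<tau> x * bernoulli_scaled \<tau> y) - (-1) ^ a * bernoulli_scaled (2 * a) \<bar>x - y\<bar>"

abbreviation one_plus :: "real \<Rightarrow> ('a \<Rightarrow> 'a \<Rightarrow> real) \<Rightarrow> 'a \<Rightarrow> 'a \<Rightarrow> real" where
  "one_plus \<gamma> k \<equiv> (\<lambda>x y. 1 + \<gamma> * k x y)"

definition has_core :: "(real \<Rightarrow> real \<Rightarrow> real \<Rightarrow> complex) \<Rightarrow> (real \<Rightarrow> real \<Rightarrow> real) \<Rightarrow> bool" where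
  "has_core K k \<longleftrightarrow> (\<forall>\<gamma> x y. K \<gamma> x y = complex_of_real (one_plus \<gamma> k x y))"

lemma decay_pos: "0 < decay \<alpha> n"
  by (simp add: decay_def)

lemma decay_nonneg: "0 \<le> decay \<alpha> n"
  by (simp add: decay_def)

lemma decay_of_nat: "decay (real a) n = 1 / real (Suc n) ^ (2 * a)"
proof -
  have "decay (real a) n = real (Suc n) powr - real (2 * a)" by (simp add: decay_def)
  also have "\<dots> = 1 / real (Suc n) ^ (2 * a)"
    unfolding powr_minus by (simp only: powr_realpow of_nat_0_less_iff zero_less_Suc inverse_eq_divide)
  finally show ?thesis .
qed

lemma decay_1: "decay 1 n = 1 / (real (Suc n))\<^sup>2"
  using decay_of_nat[of 1 n] by simp

lemma decay_1_sums: "decay 1 sums (pi\<^sup>2 / 6)"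
  using inverse_squares_sums by (simp add: decay_1[abs_def] add.commute)

lemma summable_decay:
  assumes "\<alpha> > 1/2"
  shows "summable (decay \<alpha>)"
proof -
  have "summable (\<lambda>n. real n powr (- 2 * \<alpha>))" using assms by (simp add: summable_real_powr_iff)
  thus ?thesis unfolding decay_def by (subst summable_Suc_iff)
qed

lemma summable_abs_decay_mult:
  assumes "\<alpha> > 1/2" "\<And>n. \<bar>g n\<bar> \<le> B"
  shows "summable (\<lambda>n. \<bar>decay \<alpha> n * g n\<bar>)"
proof (rule summable_comparison_test')
  show "summable (\<lambda>n. decay \<alpha> n * B)" by (intro summable_mult2 summable_decay assms)
qed (use decay_nonneg assms(2) in \<open>auto simp: abs_mult intro!: mult_left_mono\<close>)

lemma decay_series_sums:
  assumes "\<alpha> > 1/2" "\<And>n x y. \<bar>p n x y\<bar> \<le> B"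
  shows "(\<lambda>n. decay \<alpha> n * p n x y) sums decay_series \<alpha> p x y"
  unfolding decay_series_def
  by (rule summable_sums[OF summable_rabs_cancel[OF summable_abs_decay_mult[OF assms]]])

lemma continuous_on_decay_series:
  fixes g :: "nat \<Rightarrow> real \<Rightarrow> real"
  assumes \<alpha>: "\<alpha> > 1/2" and bound: "\<And>n x. \<bar>g n x\<bar> \<le> B" and g: "\<And>n. continuous_on A (g n)"
  shows "continuous_on A (\<lambda>x. \<Sum>n. decay \<alpha> n * g n x)"
proof (rule uniform_limit_theorem)
  show "uniform_limit A (\<lambda>N x. \<Sum>n<N. decay \<alpha> n * g n x) (\<lambda>x. \<Sum>n. decay \<alpha> n * g n x) sequentially"
  proof (rule Weierstrass_m_test)
    show "norm (decay \<alpha> n * g n x) \<le> decay \<alpha> n * B" for n x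
      using bound[of n x] decay_nonneg[of \<alpha> n] by (simp add: abs_mult mult_left_mono)
    show "summable (\<lambda>n. decay \<alpha> n * B)" by (intro summable_mult2 summable_decay \<alpha>)
  qed
qed (auto intro!: continuous_intros g always_eventually)

lemma quad_form_decay_series_sums:
  assumes "\<alpha> > 1/2" "\<And>n x y. \<bar>p n x y\<bar> \<le> B"
  shows "(\<lambda>n. decay \<alpha> n * quad_form S c (p n)) sums quad_form S c (decay_series \<alpha> p)"
proof -
  have "(\<lambda>n. \<Sum>x\<in>S. \<Sum>y\<in>S. c x * c y * (decay \<alpha> n * p n x y)) sums quad_form S c (decay_series \<alpha> p)"
    unfolding quad_form_def by (intro sums_sum sums_mult decay_series_sums[of \<alpha> p B] assms)
  thus ?thesis by (simp add: quad_form_def sum_distrib_left mult_ac)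
qed

lemma quad_form_decay_series_le:
  assumes "\<alpha> > 1/2" "\<And>n x y. \<bar>p n x y\<bar> \<le> B" "\<And>N. (\<Sum>n<N. decay \<alpha> n * quad_form S c (p n)) \<le> M"
  shows "quad_form S c (decay_series \<alpha> p) \<le> M"
  using quad_form_decay_series_sums[of \<alpha> p B S c, OF assms(1,2)] assms(3) unfolding sums_def
  by (intro LIMSEQ_le_const2) auto

lemma psd_on_decay_series:
  assumes "\<alpha> > 1/2" "\<And>n x y. \<bar>p n x y\<bar> \<le> B" and p: "\<And>n. psd_on X (p n)"
  shows "psd_on X (decay_series \<alpha> p)"
proof (rule psd_onI)
  show "decay_series \<alpha> p x y = decay_series \<alpha> p y x" if "x \<in> X" "y \<in> X" for x y
    unfolding decay_series_def by (simp add: psd_on_sym[OF p that])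
  show "0 \<le> quad_form S c (decay_series \<alpha> p)" if "finite S" "S \<subseteq> X" for S c
    by (rule sums_le[OF _ sums_zero quad_form_decay_series_sums[of \<alpha> p B, OF assms(1,2)]])
       (use decay_nonneg quad_form_nonneg[OF p that] in simp)
qed

lemma term_dominated_on_decay_series:
  assumes "\<alpha> > 1/2" "\<And>n x y. \<bar>p n x y\<bar> \<le> B" and p: "\<And>n. psd_on X (p n)"
  shows "dominated_on X (p m) (decay_series \<alpha> p)"
proof (rule dominated_onI)
  fix S c assume S: "finite S" "S \<subseteq> X"
  have "(\<Sum>n\<in>{m}. decay \<alpha> n * quad_form S c (p n)) \<le> quad_form S c (decay_series \<alpha> p)"
    unfolding sums_unique[OF quad_form_decay_series_sums[of \<alpha> p B S c, OF assms(1,2)]]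
    using sums_summable[OF quad_form_decay_series_sums[of \<alpha> p B S c, OF assms(1,2)]]
    by (intro sum_le_suminf) (simp_all add: decay_nonneg quad_form_nonneg[OF p S])
  thus "quad_form S c (p m) \<le> (1 / decay \<alpha> m) * quad_form S c (decay_series \<alpha> p)"
    using decay_pos[of \<alpha> m] by (simp add: field_simps)
qed (use psd_on_decay_series[of \<alpha> p B X] assms decay_nonneg in auto)

lemma abs_kor_term_le: "\<bar>kor_term n x y\<bar> \<le> 2"
  by (simp add: kor_term_def abs_mult)

lemma abs_cos_term_le: "\<bar>cos_term n x y\<bar> \<le> 2"
  by (simp add: cos_term_def abs_mult mult_le_one)

lemma quad_form_cos_term:
  "quad_form S c (cos_term n) = 2 * (weighted_sum S c (\<lambda>x. cos (pi * real (Suc n) * x)))\<^sup>2"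
  unfolding cos_term_def[abs_def] quad_form_scale quad_form_rank1 ..

lemma quad_form_kor_term:
  "quad_form S c (kor_term n) = 2 * (weighted_sum S c (\<lambda>x. cos (2 * pi * real (Suc n) * x)))\<^sup>2
     + 2 * (weighted_sum S c (\<lambda>x. sin (2 * pi * real (Suc n) * x)))\<^sup>2"
  unfolding kor_term_def[abs_def]
    quad_form_scale right_diff_distrib cos_diff quad_form_add quad_form_rank1
  by simp

lemma psd_on_cos_term: "psd_on X (cos_term n)"
  by (rule psd_onI) (simp_all add: quad_form_cos_term cos_term_def mult.commute)

lemma psd_on_kor_term: "psd_on X (kor_term n)"
proof (rule psd_onI)
  show "kor_term n x y = kor_term n y x" for x y
    using cos_minus[of "2 * pi * real (Suc n) * (x - y)"] unfolding kor_term_def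
    by (metis minus_diff_eq mult_minus_right)
qed (simp add: quad_form_kor_term)

lemmas psd_on_cos_core = psd_on_decay_series[OF _ abs_cos_term_le psd_on_cos_term]
lemmas psd_on_kor_core = psd_on_decay_series[OF _ abs_kor_term_le psd_on_kor_term]

lemma cos_dominated_on_cos_core:
  assumes "\<alpha> > 1/2"
  shows "dominated_on X (rank1 (\<lambda>x. cos (pi * x))) (cos_core \<alpha>)"
proof (rule dominated_on_trans)
  show "dominated_on X (rank1 (\<lambda>x. cos (pi * x))) (cos_term 0)"
    by (rule dominated_onI[of _ _ _ 1])
       (simp_all add: psd_on_rank1 psd_on_cos_term quad_form_rank1 quad_form_cos_term)
  show "dominated_on X (cos_term 0) (cos_core \<alpha>)"
    by (rule term_dominated_on_decay_series[OF assms abs_cos_term_le psd_on_cos_term])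
qed

lemma sin_dominated_on_kor_core:
  assumes "\<alpha> > 1/2"
  shows "dominated_on X (rank1 (\<lambda>x. sin (2 * pi * x))) (kor_core \<alpha>)"
proof (rule dominated_on_trans)
  show "dominated_on X (rank1 (\<lambda>x. sin (2 * pi * x))) (kor_term 0)"
    by (rule dominated_onI[of _ _ _ 1])
       (simp_all add: psd_on_rank1 psd_on_kor_term quad_form_rank1 quad_form_kor_term)
  show "dominated_on X (kor_term 0) (kor_core \<alpha>)"
    by (rule term_dominated_on_decay_series[OF assms abs_kor_term_le psd_on_kor_term])
qed

lemma kor_core_dominated_on_korcos_core:
  assumes "\<alpha> > 1/2"
  shows "dominated_on X (kor_core \<alpha>) (korcos_core \<alpha>)"
  using dominated_on_scale[OF psd_on_kor_core[OF assms], of 1 "1/2" X] assms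
  by (intro dominated_on_trans[OF _ dominated_on_add_right]
    psd_on_scale psd_on_kor_core psd_on_cos_core) auto

lemma cos_core_dominated_on_korcos_core:
  assumes "\<alpha> > 1/2"
  shows "dominated_on X (cos_core \<alpha>) (korcos_core \<alpha>)"
proof -
  have "dominated_on X (cos_core \<alpha>) (\<lambda>x y. (1 / 2) * cos_core \<alpha> x y + (1 / 2) * kor_core \<alpha> x y)"
    using dominated_on_scale[OF psd_on_cos_core[OF assms], of 1 "1/2" X] assms
    by (intro dominated_on_trans[OF _ dominated_on_add_right]
      psd_on_scale psd_on_kor_core psd_on_cos_core) auto
  thus ?thesis by (simp add: add.commute)
qed

lemma korcos_core_dominated_on:
  assumes "dominated_on X (kor_core \<alpha>) m" "dominated_on X (cos_core \<alpha>) m"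
  shows "dominated_on X (korcos_core \<alpha>) m"
proof (rule dominated_on_add)
  have half: "dominated_on X (\<lambda>x y. (1 / 2) * k x y) k" if "psd_on X k" for k
    using dominated_on_scale[OF that, of "1/2" 1] by simp
  show "dominated_on X (\<lambda>x y. (1 / 2) * kor_core \<alpha> x y) m"
    "dominated_on X (\<lambda>x y. (1 / 2) * cos_core \<alpha> x y) m"
    using assms half dominated_on_psd(1) dominated_on_trans by blast+
qed

lemma has_core_K_sob: "has_core (K_sob a) (sob_core a)"
  by (simp add: has_core_def K_sob_def sob_core_def bernoulli_scaled_def power2_eq_square
    right_diff_distrib)

lemma r_coef_Suc:
  "r_coef \<alpha> \<gamma> (int (Suc n)) = \<gamma> * decay \<alpha> n" "r_coef \<alpha> \<gamma> (- int (Suc n)) = \<gamma> * decay \<alpha> n"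
  by (simp_all add: r_coef_def decay_def add.commute)

lemma has_core_K_cos:
  assumes \<alpha>: "\<alpha> > 1/2"
  shows "has_core (K_cos \<alpha>) (cos_core \<alpha>)"
  unfolding has_core_def
proof (intro allI)
  fix \<gamma> x y
  define f where "f k = complex_of_real (r_coef \<alpha> \<gamma> (int k) * (sqrt 2 * cos (pi * real k * x)) *
    (sqrt 2 * cos (pi * real k * y)))" for k
  have f: "f (Suc n) = complex_of_real (\<gamma> * (decay \<alpha> n * cos_term n x y))" for n
  proof -
    have "sqrt 2 * u * (sqrt 2 * v) = 2 * (u * v)" for u v by simp
    thus ?thesis unfolding f_def cos_term_def r_coef_Suc by (simp only: mult.assoc)
  qed
  have "summable (\<lambda>n. norm (f (Suc n)))"
    unfolding f norm_of_real abs_mult[of \<gamma>]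
    by (intro summable_mult summable_abs_decay_mult[OF \<alpha> abs_cos_term_le])
  moreover have "(\<lambda>n. f (Suc n)) sums complex_of_real (\<gamma> * cos_core \<alpha> x y)"
    unfolding f by (intro sums_of_real sums_mult decay_series_sums[OF \<alpha> abs_cos_term_le])
  ultimately have "((\<lambda>n. f (Suc n)) has_sum complex_of_real (\<gamma> * cos_core \<alpha> x y)) UNIV"
    by (rule norm_summable_imp_has_sum)
  hence "(f has_sum complex_of_real (\<gamma> * cos_core \<alpha> x y)) (Suc ` UNIV)"
    by (subst has_sum_reindex) (auto simp: o_def)
  moreover have "Suc ` UNIV = {1..}" by (auto simp: image_iff) (metis Suc_le_D)
  ultimately show "K_cos \<alpha> \<gamma> x y = complex_of_real (1 + \<gamma> * cos_core \<alpha> x y)"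
    unfolding K_cos_def f_def[symmetric] by (simp add: infsumI)
qed

lemma has_sum_int_symmetric:
  fixes f :: "int \<Rightarrow> 'a :: banach"
  assumes pos: "summable (\<lambda>n. norm (f (int (Suc n))))" and neg: "summable (\<lambda>n. norm (f (- int (Suc n))))"
    and sums: "(\<lambda>n. f (int (Suc n)) + f (- int (Suc n))) sums A"
  shows "(f has_sum (f 0 + A)) UNIV"
proof -
  define P where "P = range (\<lambda>n. int (Suc n))"
  define M where "M = range (\<lambda>n. - int (Suc n))"
  note sums' = summable_sums[OF summable_norm_cancel]
  have "(f has_sum (\<Sum>n. f (int (Suc n)))) P"
    unfolding P_def by (subst has_sum_reindex)
      (use norm_summable_imp_has_sum[OF pos sums'[OF pos]] in \<open>auto simp: o_def inj_def\<close>)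
  moreover have "(f has_sum (\<Sum>n. f (- int (Suc n)))) M"
    unfolding M_def by (subst has_sum_reindex)
      (use norm_summable_imp_has_sum[OF neg sums'[OF neg]] in \<open>auto simp: o_def inj_def\<close>)
  ultimately have "(f has_sum ((\<Sum>n. f (int (Suc n))) + (\<Sum>n. f (- int (Suc n))))) (P \<union> M)"
    by (rule has_sum_Un_disjoint) (auto simp: P_def M_def)
  also have "(\<Sum>n. f (int (Suc n))) + (\<Sum>n. f (- int (Suc n))) = A"
    using sums_unique2[OF sums_add[OF sums'[OF pos] sums'[OF neg]] sums] .
  finally have "(f has_sum (f 0 + A)) ({0} \<union> (P \<union> M))"
    by (intro has_sum_Un_disjoint) (use has_sum_finite[of "{0}" f] in \<open>auto simp: P_def M_def\<close>)
  moreover have "h \<in> {0} \<union> (P \<union> M)" for h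
  proof -
    consider "h = 0" | "h = int (Suc (nat (h - 1)))" | "h = - int (Suc (nat (- h - 1)))" by linarith
    thus ?thesis unfolding P_def M_def by cases blast+
  qed
  ultimately show ?thesis by (metis UNIV_eq_I)
qed

lemma has_core_K_kor:
  assumes \<alpha>: "\<alpha> > 1/2"
  shows "has_core (K_kor \<alpha>) (kor_core \<alpha>)"
  unfolding has_core_def
proof (intro allI)
  fix \<gamma> x y
  define f where "f h = complex_of_real (r_coef \<alpha> \<gamma> h) *
     exp (2 * complex_of_real pi * \<i> * of_int h * complex_of_real (x - y))" for h :: int
  have f_cis: "f h = complex_of_real (r_coef \<alpha> \<gamma> h) * cis (2 * pi * of_int h * (x - y))" for h
    unfolding f_def cis_conv_exp by (simp add: algebra_simps)
  have "summable (\<lambda>n. norm (f (int (Suc n))))" "summable (\<lambda>n. norm (f (- int (Suc n))))"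
    unfolding f_cis r_coef_Suc norm_mult norm_of_real norm_cis mult_1_right
    using decay_nonneg summable_decay[OF \<alpha>] by (simp_all add: abs_mult summable_mult)
  moreover have "f (int (Suc n)) + f (- int (Suc n)) =
      complex_of_real (\<gamma> * (decay \<alpha> n * kor_term n x y))" for n
  proof -
    define \<phi> where "\<phi> = 2 * pi * real (Suc n) * (x - y)"
    have "2 * pi * of_int (int (Suc n)) * (x - y) = \<phi>" "2 * pi * of_int (- int (Suc n)) * (x - y) = - \<phi>"
      by (simp_all add: \<phi>_def algebra_simps)
    thus ?thesis unfolding f_cis r_coef_Suc kor_term_def \<phi>_def[symmetric] by (simp add: complex_eq_iff)
  qed
  hence "(\<lambda>n. f (int (Suc n)) + f (- int (Suc n))) sums complex_of_real (\<gamma> * kor_core \<alpha> x y)"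
    by (simp only:) (intro sums_of_real sums_mult decay_series_sums[OF \<alpha> abs_kor_term_le])
  ultimately have "(f has_sum (f 0 + complex_of_real (\<gamma> * kor_core \<alpha> x y))) UNIV"
    by (rule has_sum_int_symmetric)
  moreover have "f 0 = 1" by (simp add: f_def r_coef_def)
  ultimately show "K_kor \<alpha> \<gamma> x y = complex_of_real (1 + \<gamma> * kor_core \<alpha> x y)"
    unfolding K_kor_def f_def[symmetric] by (simp add: infsumI)
qed

lemma has_core_K_korcos:
  assumes "\<alpha> > 1/2"
  shows "has_core (K_korcos \<alpha>) (korcos_core \<alpha>)"
  using has_core_K_kor[OF assms] has_core_K_cos[OF assms]
  by (simp add: has_core_def K_korcos_def add_divide_distrib distrib_left)

section \<open>Domination by the Sobolev kernel\<close>

definition peano_kernel :: "nat \<Rightarrow> real set \<Rightarrow> (real \<Rightarrow> real) \<Rightarrow> real \<Rightarrow> real" where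
  "peano_kernel a S c t = weighted_sum S c (\<lambda>x. bernoulli_periodic a x t)"

lemma bounded_measurable_peano_kernel [bounded_measurable_intros]:
  "bounded_measurable (peano_kernel a S c)"
  unfolding peano_kernel_def weighted_sum_def by (intro bounded_measurable_intros)

lemma integral_peano_kernel_mult:
  assumes "bounded_measurable f"
  shows "(\<integral>t. peano_kernel a S c t * f t \<partial>lborel01) =
    weighted_sum S c (\<lambda>x. \<integral>t. bernoulli_periodic a x t * f t \<partial>lborel01)"
  unfolding peano_kernel_def weighted_sum_def sum_distrib_right mult.assoc
  by (simp add: integral_bounded_measurable bounded_measurable_intros assms)

lemma integral_peano_kernel:
  assumes "S \<subseteq> {0..1}" "1 \<le> a"
  shows "integral\<^sup>L lborel01 (peano_kernel a S c) = 0"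
proof -
  have "integral\<^sup>L lborel01 (peano_kernel a S c) =
      weighted_sum S c (\<lambda>x. integral\<^sup>L lborel01 (bernoulli_periodic a x))"
    using integral_peano_kernel_mult[OF bounded_measurable_const[of 1]] by simp
  also have "\<dots> = weighted_sum S c (\<lambda>x. 0)"
    by (rule weighted_sum_cong) (use assms integral_bernoulli_periodic in blast)
  finally show ?thesis by (simp add: weighted_sum_def)
qed

lemma integral_peano_kernel_power2:
  assumes S: "S \<subseteq> {0..1}" and a: "1 \<le> a"
  shows "(\<integral>t. (peano_kernel a S c t)\<^sup>2 \<partial>lborel01) =
    quad_form S c (\<lambda>x y. - ((-1) ^ a * bernoulli_scaled (2 * a) \<bar>x - y\<bar>))"
proof -
  have "(\<integral>t. (peano_kernel a S c t)\<^sup>2 \<partial>lborel01) =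
      weighted_sum S c (\<lambda>x. \<integral>t. peano_kernel a S c t * bernoulli_periodic a x t \<partial>lborel01)"
    unfolding power2_eq_square integral_peano_kernel_mult[OF bounded_measurable_peano_kernel]
    by (simp only: mult.commute)
  also have "\<dots> = quad_form S c (\<lambda>x y. \<integral>t. bernoulli_periodic a y t * bernoulli_periodic a x t \<partial>lborel01)"
    unfolding integral_peano_kernel_mult[OF bounded_measurable_bernoulli_periodic] quad_form_altdef ..
  also have "\<dots> = quad_form S c (\<lambda>x y. - ((-1) ^ a * bernoulli_scaled (2 * a) \<bar>x - y\<bar>))"
  proof (rule quad_form_cong)
    fix x y assume "x \<in> S" "y \<in> S"
    hence "x \<in> {0..1}" "y \<in> {0..1}" using S by auto
    thus "(\<integral>t. bernoulli_periodic a y t * bernoulli_periodic a x t \<partial>lborel01) =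
        - ((-1) ^ a * bernoulli_scaled (2 * a) \<bar>x - y\<bar>)"
      using integral_bernoulli_periodic_mult[OF _ _ a, of y x] by (simp only: abs_minus_commute)
  qed
  finally show ?thesis .
qed

lemma quad_form_sob_core:
  assumes "S \<subseteq> {0..1}" "1 \<le> a"
  shows "quad_form S c (sob_core a) =
    (\<Sum>\<tau>=1..a. (weighted_sum S c (bernoulli_scaled \<tau>))\<^sup>2) + (\<integral>t. (peano_kernel a S c t)\<^sup>2 \<partial>lborel01)"
  unfolding sob_core_def[abs_def] integral_peano_kernel_power2[OF assms] diff_conv_add_uminus
    quad_form_add quad_form_sum quad_form_rank1 ..

lemma psd_on_sob_core:
  assumes "1 \<le> a"
  shows "psd_on {0..1} (sob_core a)"
proof (rule psd_onI)
  show "sob_core a x y = sob_core a y x" for x y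
    by (simp add: sob_core_def abs_minus_commute mult.commute)
qed (use assms in \<open>simp add: quad_form_sob_core sum_nonneg\<close>)

text \<open>The second factor on the right is the squared Sobolev norm of \<open>F 0\<close> modulo constants. The top
  order term of the Euler-Maclaurin formula is absorbed into \<open>V\<close>, since \<open>peano_kernel a S c\<close> has mean 0;
  this makes the constant sharp for \<open>a = 1\<close>.\<close>

lemma weighted_sum_smooth_power2_le:
  fixes F :: "nat \<Rightarrow> real \<Rightarrow> real"
  assumes F: "\<And>k t. (F k has_real_derivative F (Suc k) t) (at t)" and S: "S \<subseteq> {0..1}" and a: "1 \<le> a"
  shows "(weighted_sum S c (F 0) - weighted_sum S c (\<lambda>_. 1) * integral\<^sup>L lborel01 (F 0))\<^sup>2 \<le>
    quad_form S c (sob_core a) *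
      ((\<Sum>\<tau>\<in>{1..<a}. (integral\<^sup>L lborel01 (F \<tau>))\<^sup>2) + (\<integral>t. (F a t)\<^sup>2 \<partial>lborel01))"
proof -
  define b where "b \<tau> = weighted_sum S c (bernoulli_scaled \<tau>)" for \<tau>
  define m where "m \<tau> = integral\<^sup>L lborel01 (F \<tau>)" for \<tau>
  define V where "V t = b a - peano_kernel a S c t" for t
  have bm [bounded_measurable_intros]: "bounded_measurable (F k)" for k
    by (intro bounded_measurable_continuous DERIV_continuous_on)
      (rule has_field_derivative_at_within[OF F])
  have V [bounded_measurable_intros]: "bounded_measurable V"
    unfolding V_def by (intro bounded_measurable_intros)
  have split: "sum f {1..a} = sum f {1..<a} + f a" for f :: "nat \<Rightarrow> real"
    using a by (cases a) (auto simp: atLeastLessThanSuc_atLeastAtMost)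
  have VF: "(\<integral>t. V t * F a t \<partial>lborel01) = b a * m a - (\<integral>t. peano_kernel a S c t * F a t \<partial>lborel01)"
    unfolding V_def left_diff_distrib m_def
    by (simp add: integral_bounded_measurable bounded_measurable_intros)
  have "weighted_sum S c (F 0) = weighted_sum S c (\<lambda>x. m 0 * 1 + (\<Sum>\<tau>=1..a. bernoulli_scaled \<tau> x * m \<tau>)
      - (\<integral>t. bernoulli_periodic a x t * F a t \<partial>lborel01))"
    by (rule weighted_sum_cong) (use Euler_Maclaurin[of F, OF F _ a] S in \<open>auto simp: m_def\<close>)
  also have "\<dots> =
      m 0 * weighted_sum S c (\<lambda>_. 1) + (\<Sum>\<tau>=1..a. b \<tau> * m \<tau>) - (\<integral>t. peano_kernel a S c t * F a t \<partial>lborel01)"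
    unfolding integral_peano_kernel_mult[OF bm] b_def
    by (simp only: weighted_sum_add weighted_sum_diff weighted_sum_mult_left weighted_sum_sum
      weighted_sum_mult_right)
  finally have eq: "weighted_sum S c (F 0) - weighted_sum S c (\<lambda>_. 1) * m 0 =
      (\<Sum>\<tau>\<in>{1..<a}. b \<tau> * m \<tau>) + (\<integral>t. V t * F a t \<partial>lborel01)"
    unfolding split VF by simp
  have "(\<integral>t. (V t)\<^sup>2 \<partial>lborel01) =
      (\<integral>t. (b a)\<^sup>2 - 2 * b a * peano_kernel a S c t + (peano_kernel a S c t)\<^sup>2 \<partial>lborel01)"
    unfolding V_def power2_diff by (simp only: diff_add_eq)
  also have "\<dots> = (b a)\<^sup>2 + (\<integral>t. (peano_kernel a S c t)\<^sup>2 \<partial>lborel01)"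
    by (simp add: integral_bounded_measurable bounded_measurable_intros integral_peano_kernel[OF S a])
  finally have "(\<Sum>\<tau>\<in>{1..<a}. (b \<tau>)\<^sup>2) + (\<integral>t. (V t)\<^sup>2 \<partial>lborel01) = quad_form S c (sob_core a)"
    unfolding quad_form_sob_core[OF S a] split b_def by simp
  thus ?thesis
    using Cauchy_Schwarz_sum_integral[OF V bm[of a], of b m "{1..<a}"]
    unfolding eq[unfolded m_def] m_def by simp
qed

lemma sin_cos_of_nat_mult:
  assumes "sin \<kappa> = (0::real)"
  shows "sin (\<kappa> * real m) = 0" and "cos \<kappa> = 1 \<Longrightarrow> cos (\<kappa> * real m) = 1"
  using assms by (induction m) (simp_all add: distrib_left sin_add cos_add)

lemma integral_cos_eq_0:
  assumes "sin \<kappa> = 0" "cos \<kappa> = 1 \<or> sin \<theta> = 0" "\<kappa> \<noteq> 0" "m \<noteq> 0"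
  shows "(\<integral>t. cos (\<kappa> * real m * t + \<theta>) \<partial>lborel01) = 0"
proof -
  have "(\<integral>t. cos (\<kappa> * real m * t + \<theta>) \<partial>lborel01) =
      sin (\<kappa> * real m * 1 + \<theta>) / (\<kappa> * real m) - sin (\<kappa> * real m * 0 + \<theta>) / (\<kappa> * real m)"
    by (rule integral_lborel01_FTC[of "{}"])
       (use assms in \<open>auto intro!: continuous_intros derivative_eq_intros bounded_measurable_intros\<close>)
  also have "sin (\<kappa> * real m * 1 + \<theta>) = sin \<theta>"
    using assms(2) sin_cos_of_nat_mult[OF assms(1), of m] by (auto simp: sin_add)
  finally show ?thesis by simp
qed

lemma integral_cos_mult_cos:
  assumes \<kappa>: "sin \<kappa> = 0" "cos \<kappa> = 1 \<or> sin (2 * \<theta>) = 0" "\<kappa> \<noteq> 0"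
  shows "(\<integral>t. cos (\<kappa> * real (Suc i) * t + \<theta>) * cos (\<kappa> * real (Suc j) * t + \<theta>) \<partial>lborel01) =
    (if i = j then 1 / 2 else 0)"
proof (induction i j rule: linorder_wlog)
  case (sym i j)
  thus ?case by (simp only: mult.commute eq_commute)
next
  case (le i j)
  have "cos (\<kappa> * real (Suc i) * t + \<theta>) * cos (\<kappa> * real (Suc j) * t + \<theta>) =
      (1 / 2) * cos (\<kappa> * real (j - i) * t + 0)
      + (1 / 2) * cos (\<kappa> * real (Suc (Suc (i + j))) * t + 2 * \<theta>)" for t
    using le cos_minus[of "\<kappa> * real (j - i) * t"] unfolding cos_times_cos
    by (simp add: of_nat_diff algebra_simps add_divide_distrib)
  hence "(\<integral>t. cos (\<kappa> * real (Suc i) * t + \<theta>) * cos (\<kappa> * real (Suc j) * t + \<theta>) \<partial>lborel01) =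
      (1 / 2) * (\<integral>t. cos (\<kappa> * real (j - i) * t + 0) \<partial>lborel01)
      + (1 / 2) * (\<integral>t. cos (\<kappa> * real (Suc (Suc (i + j))) * t + 2 * \<theta>) \<partial>lborel01)"
    by (simp only: integral_bounded_measurable bounded_measurable_intros integral_mult_right_zero)
  also have "(\<integral>t. cos (\<kappa> * real (Suc (Suc (i + j))) * t + 2 * \<theta>) \<partial>lborel01) = 0"
    using \<kappa> by (intro integral_cos_eq_0) auto
  also have "(\<integral>t. cos (\<kappa> * real (j - i) * t + 0) \<partial>lborel01) = (if i = j then 1 else 0)"
    using integral_cos_eq_0[of \<kappa> 0 "j - i"] \<kappa> le by auto
  finally show ?case by (cases "i = j") simp_all
qed

definition cos_sum_deriv :: "real \<Rightarrow> real \<Rightarrow> nat \<Rightarrow> (nat \<Rightarrow> real) \<Rightarrow> nat \<Rightarrow> real \<Rightarrow> real" where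
  "cos_sum_deriv \<kappa> \<theta> N b k t =
    (\<Sum>n<N. b n * (\<kappa> * real (Suc n)) ^ k * cos (\<kappa> * real (Suc n) * t + (\<theta> + real k * (pi / 2))))"

lemma bounded_measurable_cos_sum_deriv [bounded_measurable_intros]:
  "bounded_measurable (cos_sum_deriv \<kappa> \<theta> N b k)"
  unfolding cos_sum_deriv_def[abs_def] by (intro bounded_measurable_intros)

lemma DERIV_cos_sum_deriv:
  "(cos_sum_deriv \<kappa> \<theta> N b k has_real_derivative cos_sum_deriv \<kappa> \<theta> N b (Suc k) t) (at t)"
proof -
  have "cos (u + (\<theta> + real (Suc k) * (pi / 2))) = - sin (u + (\<theta> + real k * (pi / 2)))" for u
    using cos_add[of "u + (\<theta> + real k * (pi / 2))" "pi / 2"]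
    by (simp add: algebra_simps add_divide_distrib)
  hence "((\<lambda>t. b n * w ^ k * cos (w * t + (\<theta> + real k * (pi / 2)))) has_real_derivative
      b n * w ^ Suc k * cos (w * t + (\<theta> + real (Suc k) * (pi / 2)))) (at t)" for n w
    by (simp only:) (rule derivative_eq_intros refl | simp)+
  thus ?thesis unfolding cos_sum_deriv_def[abs_def] by (intro DERIV_sum)
qed

lemma integral_cos_sum_eq_0:
  assumes "sin \<kappa> = 0" "cos \<kappa> = 1 \<or> sin \<theta> = 0" "\<kappa> \<noteq> 0"
  shows "integral\<^sup>L lborel01 (cos_sum_deriv \<kappa> \<theta> N b 0) = 0"
proof -
  have "integral\<^sup>L lborel01 (cos_sum_deriv \<kappa> \<theta> N b 0) =
      (\<Sum>n<N. b n * (\<integral>t. cos (\<kappa> * real (Suc n) * t + \<theta>) \<partial>lborel01))"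
    unfolding cos_sum_deriv_def by (simp add: integral_bounded_measurable bounded_measurable_intros)
  also have "\<dots> = 0" using integral_cos_eq_0[OF assms, of "Suc _"] by simp
  finally show ?thesis .
qed

lemma integral_cos_sum_deriv_power2:
  assumes \<kappa>: "sin \<kappa> = 0" "cos \<kappa> = 1 \<or> sin \<theta> = 0" "\<kappa> \<noteq> 0"
  shows "(\<integral>t. (cos_sum_deriv \<kappa> \<theta> N b k t)\<^sup>2 \<partial>lborel01) =
      (\<Sum>n<N. (b n)\<^sup>2 * (\<kappa> * real (Suc n)) ^ (2 * k)) / 2"
proof -
  define B where "B n = b n * (\<kappa> * real (Suc n)) ^ k" for n
  define e where "e n t = cos (\<kappa> * real (Suc n) * t + (\<theta> + real k * (pi / 2)))" for n t
  have [bounded_measurable_intros]: "bounded_measurable (e n)" for n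
    unfolding e_def by (intro bounded_measurable_intros)
  have "sin (2 * (\<theta> + real k * (pi / 2))) = sin (2 * \<theta>) * cos (real k * pi)"
    by (simp add: distrib_left sin_add)
  hence "cos \<kappa> = 1 \<or> sin (2 * (\<theta> + real k * (pi / 2))) = 0" using \<kappa>(2) by (auto simp: sin_double)
  hence orth: "(\<integral>t. e i t * e j t \<partial>lborel01) = (if i = j then 1 / 2 else 0)" for i j
    unfolding e_def by (intro integral_cos_mult_cos \<kappa>)
  have "(\<integral>t. (cos_sum_deriv \<kappa> \<theta> N b k t)\<^sup>2 \<partial>lborel01) =
      (\<integral>t. (\<Sum>i<N. \<Sum>j<N. B i * B j * (e i t * e j t)) \<partial>lborel01)"
    by (simp add: cos_sum_deriv_def B_def e_def power2_eq_square sum_product mult_ac)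
  also have "\<dots> = (\<Sum>i<N. \<Sum>j<N. B i * B j * (\<integral>t. e i t * e j t \<partial>lborel01))"
    by (simp add: integral_bounded_measurable bounded_measurable_intros)
  also have "\<dots> = (\<Sum>i<N. \<Sum>j<N. if j = i then (B i)\<^sup>2 / 2 else 0)"
    unfolding orth by (intro sum.cong refl) (auto simp: power2_eq_square)
  also have "\<dots> = (\<Sum>n<N. (b n)\<^sup>2 * (\<kappa> * real (Suc n)) ^ (2 * k)) / 2"
    by (simp add: sum_divide_distrib B_def power_mult_distrib power_mult[symmetric] mult.commute[of k 2]
      del: of_nat_Suc)
  finally show ?thesis .
qed

lemma integral_cos_sum_deriv_decay_power2_le:
  assumes \<kappa>: "sin \<kappa> = 0" "cos \<kappa> = 1 \<or> sin \<theta> = 0" "1 \<le> \<kappa>" and k: "k \<le> a"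
  shows "(\<integral>t. (cos_sum_deriv \<kappa> \<theta> N (\<lambda>n. decay (real a) n * v n) k t)\<^sup>2 \<partial>lborel01) \<le>
    \<kappa> ^ (2 * a) * (\<Sum>n<N. decay (real a) n * (v n)\<^sup>2) / 2"
proof -
  have \<omega>: "1 \<le> \<kappa> * real (Suc n)" for n using \<kappa>(3) mult_mono[of 1 \<kappa> 1 "real (Suc n)"] by simp
  have "(\<integral>t. (cos_sum_deriv \<kappa> \<theta> N (\<lambda>n. decay (real a) n * v n) k t)\<^sup>2 \<partial>lborel01) =
      (\<Sum>n<N. (decay (real a) n * v n)\<^sup>2 * (\<kappa> * real (Suc n)) ^ (2 * k)) / 2"
    by (rule integral_cos_sum_deriv_power2[OF \<kappa>(1,2)]) (use \<kappa>(3) in simp)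
  also have "\<dots> \<le> (\<Sum>n<N. (decay (real a) n * v n)\<^sup>2 * (\<kappa> * real (Suc n)) ^ (2 * a)) / 2"
    using \<omega> k by (intro divide_right_mono sum_mono mult_left_mono power_increasing) auto
  also have "\<dots> = \<kappa> ^ (2 * a) * (\<Sum>n<N. decay (real a) n * (v n)\<^sup>2) / 2"
    unfolding sum_distrib_left
    by (simp add: decay_of_nat power_mult_distrib power2_eq_square mult_ac del: of_nat_Suc)
  finally show ?thesis .
qed

text \<open>Duality: apply \<open>weighted_sum_smooth_power2_le\<close> to the cosine sum whose \<open>n\<close>-th coefficient is
  the decay times the weighted sum of the \<open>n\<close>-th cosine.\<close>

lemma sum_decay_weighted_cos_le:
  assumes S: "S \<subseteq> {0..1}" and a: "1 \<le> a"
    and \<kappa>: "sin \<kappa> = 0" "cos \<kappa> = 1 \<or> sin \<theta> = 0" "1 \<le> \<kappa>"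
  shows "(\<Sum>n<N. decay (real a) n * (2 * (weighted_sum S c (\<lambda>x. cos (\<kappa> * real (Suc n) * x + \<theta>)))\<^sup>2)) \<le>
    real a * \<kappa> ^ (2 * a) * quad_form S c (sob_core a)"
proof -
  define v where "v n = weighted_sum S c (\<lambda>x. cos (\<kappa> * real (Suc n) * x + \<theta>))" for n
  define F where "F = cos_sum_deriv \<kappa> \<theta> N (\<lambda>n. decay (real a) n * v n)"
  define Q where "Q = (\<Sum>n<N. decay (real a) n * (v n)\<^sup>2)"
  define E where "E = \<kappa> ^ (2 * a) * Q / 2"
  have norm: "(\<integral>t. (F k t)\<^sup>2 \<partial>lborel01) \<le> E" if "k \<le> a" for k
    unfolding F_def E_def Q_def by (rule integral_cos_sum_deriv_decay_power2_le[OF \<kappa> that])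
  have "(\<Sum>\<tau>\<in>{1..<a}. (integral\<^sup>L lborel01 (F \<tau>))\<^sup>2) \<le> (\<Sum>\<tau>\<in>{1..<a}. E)"
    using norm unfolding F_def
    by (intro sum_mono order_trans[OF power2_integral_le] bounded_measurable_intros) auto
  hence energy: "(\<Sum>\<tau>\<in>{1..<a}. (integral\<^sup>L lborel01 (F \<tau>))\<^sup>2) + (\<integral>t. (F a t)\<^sup>2 \<partial>lborel01) \<le> real a * E"
    using norm[of a] a by (simp add: of_nat_diff left_diff_distrib)
  have mean: "integral\<^sup>L lborel01 (F 0) = 0"
    unfolding F_def by (rule integral_cos_sum_eq_0[OF \<kappa>(1,2)]) (use \<kappa>(3) in simp)
  have form_nonneg: "0 \<le> quad_form S c (sob_core a)" by (simp add: quad_form_sob_core[OF S a] sum_nonneg)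
  have "weighted_sum S c (F 0) = Q"
    by (simp add: F_def cos_sum_deriv_def[abs_def] Q_def weighted_sum_sum weighted_sum_mult_left v_def
        power2_eq_square mult.assoc)
  hence "Q\<^sup>2 \<le> quad_form S c (sob_core a) *
      ((\<Sum>\<tau>\<in>{1..<a}. (integral\<^sup>L lborel01 (F \<tau>))\<^sup>2) + (\<integral>t. (F a t)\<^sup>2 \<partial>lborel01))"
    using weighted_sum_smooth_power2_le[of F, OF _ S a, of c] mean DERIV_cos_sum_deriv
    unfolding F_def by simp
  also have "\<dots> \<le> quad_form S c (sob_core a) * (real a * E)"
    by (rule mult_left_mono[OF energy form_nonneg])
  finally have "Q * (2 * Q) \<le> Q * (real a * \<kappa> ^ (2 * a) * quad_form S c (sob_core a))"
    by (simp add: E_def power2_eq_square mult_ac)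
  moreover have "0 \<le> Q" unfolding Q_def by (intro sum_nonneg mult_nonneg_nonneg decay_nonneg) auto
  ultimately have "2 * Q \<le> real a * \<kappa> ^ (2 * a) * quad_form S c (sob_core a)"
    using form_nonneg \<kappa>(3) by (cases "Q = 0") (auto simp: mult_le_cancel_left)
  thus ?thesis unfolding Q_def v_def by (simp add: sum_distrib_left mult_ac)
qed

lemma quad_form_cos_core_le:
  assumes "S \<subseteq> {0..1}" "1 \<le> a"
  shows "quad_form S c (cos_core (real a)) \<le> real a * pi ^ (2 * a) * quad_form S c (sob_core a)"
proof (rule quad_form_decay_series_le[OF _ abs_cos_term_le])
  show "(\<Sum>n<N. decay (real a) n * quad_form S c (cos_term n)) \<le>
      real a * pi ^ (2 * a) * quad_form S c (sob_core a)" for N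
    using sum_decay_weighted_cos_le[OF assms, where \<kappa> = pi and \<theta> = 0 and N = N] pi_ge_two
    by (simp add: quad_form_cos_term)
qed (use assms in simp)

lemma cos_core_dominated_on_sob_core:
  assumes "1 \<le> a"
  shows "dominated_on {0..1} (cos_core (real a)) (sob_core a)"
  by (rule dominated_onI[OF psd_on_cos_core psd_on_sob_core _ quad_form_cos_core_le]) (use assms in auto)

lemma kor_core_dominated_on_sob_core:
  assumes a: "1 \<le> a"
  shows "dominated_on {0..1} (kor_core (real a)) (sob_core a)"
proof (rule dominated_onI[OF psd_on_kor_core psd_on_sob_core])
  let ?C = "real a * (2 * pi) ^ (2 * a)"
  fix S c assume S: "S \<subseteq> {0..1::real}"
  show "quad_form S c (kor_core (real a)) \<le> (2 * ?C) * quad_form S c (sob_core a)"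
  proof (rule quad_form_decay_series_le[OF _ abs_kor_term_le])
    fix N
    have "(\<Sum>n<N. decay (real a) n * (2 * (weighted_sum S c (\<lambda>x. cos (2 * pi * real (Suc n) * x + \<theta>)))\<^sup>2))
        \<le> ?C * quad_form S c (sob_core a)" for \<theta>
      using sum_decay_weighted_cos_le[OF S a, where \<kappa> = "2 * pi" and N = N] pi_ge_two by simp
    from this[of 0] this[of "- (pi / 2)"]
    show "(\<Sum>n<N. decay (real a) n * quad_form S c (kor_term n)) \<le> (2 * ?C) * quad_form S c (sob_core a)"
      by (simp add: quad_form_kor_term distrib_left sum.distrib cos_diff)
  qed (use a in simp)
qed (use a in auto)

section \<open>The cosine kernel of smoothness 1\<close>

lemma sob_core_1: "sob_core (Suc 0) x y =
  (x - 1 / 2) * (y - 1 / 2) + \<bar>x - y\<bar>\<^sup>2 / 2 - \<bar>x - y\<bar> / 2 + 1 / 12"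
  by (simp add: sob_core_def bernoulli_scaled_1 bernoulli_scaled_2)

lemma integral_cos_core_diag:
  assumes \<alpha>: "\<alpha> > 1/2"
  shows "(\<integral>x. cos_core \<alpha> x x \<partial>lborel01) = (\<Sum>n. decay \<alpha> n)"
proof -
  have diag: "cos_term n x x =
      2 * (cos (pi * real (Suc n) * x + 0) * cos (pi * real (Suc n) * x + 0))" for n x
    by (simp add: cos_term_def)
  have bm: "bounded_measurable (\<lambda>x. decay \<alpha> n * cos_term n x x)" for n
    unfolding diag by (intro bounded_measurable_intros)
  have int: "(\<integral>x. decay \<alpha> n * cos_term n x x \<partial>lborel01) = decay \<alpha> n" for n
    unfolding diag using integral_cos_mult_cos[of pi 0 n n] by simp
  have nonneg: "norm (decay \<alpha> n * cos_term n x x) = decay \<alpha> n * cos_term n x x" for n x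
    using decay_nonneg[of \<alpha> n] by (simp add: cos_term_def abs_mult)
  have "(\<integral>x. cos_core \<alpha> x x \<partial>lborel01) = (\<Sum>n. \<integral>x. decay \<alpha> n * cos_term n x x \<partial>lborel01)"
    unfolding decay_series_def
  proof (rule integral_suminf)
    show "AE x in lborel01. summable (\<lambda>n. norm (decay \<alpha> n * cos_term n x x))"
      using summable_abs_decay_mult[OF \<alpha> abs_cos_term_le] by simp
    show "summable (\<lambda>n. \<integral>x. norm (decay \<alpha> n * cos_term n x x) \<partial>lborel01)"
      unfolding nonneg int by (rule summable_decay[OF \<alpha>])
  qed (rule bounded_measurable_integrable[OF bm])
  thus ?thesis unfolding int .
qed

text \<open>The difference of the two sides is positive semidefinite, and by the Basel identity its
  trace vanishes.\<close>

lemma cos_core_1: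
  assumes x: "x \<in> {0..1}" and y: "y \<in> {0..1}"
  shows "cos_core 1 x y = pi\<^sup>2 * sob_core 1 x y"
proof -
  define T where "T x y = pi\<^sup>2 * sob_core 1 x y - cos_core 1 x y" for x y
  have psd: "psd_on {0..1} T"
  proof (rule psd_onI)
    show "T x y = T y x" if "x \<in> {0..1}" "y \<in> {0..1}" for x y
      using psd_on_sym[OF psd_on_sob_core[of 1] that] psd_on_sym[OF psd_on_cos_core[of 1] that]
      by (simp add: T_def)
    show "0 \<le> quad_form S c T" if "S \<subseteq> {0..1}" for S c
      using quad_form_cos_core_le[OF that, of 1 c]
      unfolding T_def[abs_def] quad_form_diff quad_form_scale by simp
  qed
  define q where "q x = (x - 1 / 2)\<^sup>2 + 1 / 12" for x :: real
  have diag: "T x x = pi\<^sup>2 * q x - cos_core 1 x x" for x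
    by (simp add: T_def sob_core_1 q_def power2_eq_square)
  have cont: "continuous_on UNIV q" "continuous_on UNIV (\<lambda>x. cos_core 1 x x)"
    unfolding q_def[abs_def] decay_series_def
    by (intro continuous_intros, intro continuous_on_decay_series[OF _ abs_cos_term_le])
       (auto simp: cos_term_def intro!: continuous_intros)
  have "(\<integral>x. q x \<partial>lborel01) = ((1 - 1 / 2) ^ 3 / 3 + 1 / 12) - ((0 - 1 / 2) ^ 3 / 3 + 0 / 12)"
    unfolding q_def[abs_def]
    by (rule integral_lborel01_FTC[of "{}"])
       (auto intro!: continuous_intros derivative_eq_intros bounded_measurable_continuous
         simp: power2_eq_square)
  also have "\<dots> = 1 / 6" by (simp add: power3_eq_cube)
  finally have "(\<integral>x. T x x \<partial>lborel01) = pi\<^sup>2 / 6 - (\<Sum>n. decay 1 n)"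
    unfolding diag using integral_cos_core_diag[of 1]
    by (simp add: integral_bounded_measurable bounded_measurable_intros bounded_measurable_continuous
      cont)
  also have "\<dots> = 0" using decay_1_sums by (simp add: sums_iff)
  finally have "T x x = 0"
    using psd_on_diag_nonneg[OF psd] x unfolding diag
    by (intro continuous_nonneg_integral_eq_0[of "\<lambda>x. pi\<^sup>2 * q x - cos_core 1 x x"]
      continuous_intros cont) auto
  hence "T x y = 0" using psd_on_power2_le[OF psd x y] by simp
  thus ?thesis by (simp add: T_def)
qed

lemma sob_core_1_dominated_on_cos_core: "dominated_on {0..1} (sob_core 1) (cos_core 1)"
proof (rule dominated_onI[of _ _ _ "1 / pi\<^sup>2"])
  fix S c assume "S \<subseteq> {0..1::real}"
  hence "quad_form S c (cos_core 1) = quad_form S c (\<lambda>x y. pi\<^sup>2 * sob_core 1 x y)"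
    by (intro quad_form_cong cos_core_1) auto
  thus "quad_form S c (sob_core 1) \<le> 1 / pi\<^sup>2 * quad_form S c (cos_core 1)"
    by (simp add: quad_form_scale)
qed (simp_all add: psd_on_sob_core psd_on_cos_core)

lemma sum_decay_1_one_minus_cos_le:
  assumes "0 \<le> t"
  shows "(\<Sum>n<N. decay 1 n * (1 - cos (pi * real (Suc n) * t))) \<le> pi\<^sup>2 / 2 * t"
proof (cases "t \<le> 1")
  case True
  have nonneg: "0 \<le> decay 1 n * (1 - cos u)" for n u using decay_nonneg[of 1 n] by simp
  have "(\<lambda>n. (decay 1 n * cos_term n 0 0 - decay 1 n * cos_term n t 0) / 2) sums
      ((cos_core 1 0 0 - cos_core 1 t 0) / 2)"
    by (intro sums_divide sums_diff decay_series_sums[OF _ abs_cos_term_le]) auto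
  also have "(cos_core 1 0 0 - cos_core 1 t 0) / 2 = pi\<^sup>2 * (t / 2 - t\<^sup>2 / 4)"
    using assms True by (simp add: cos_core_1 sob_core_1 field_simps power2_eq_square)
  also have "(\<lambda>n. (decay 1 n * cos_term n 0 0 - decay 1 n * cos_term n t 0) / 2) =
      (\<lambda>n. decay 1 n * (1 - cos (pi * real (Suc n) * t)))"
    by (simp add: cos_term_def fun_eq_iff field_simps)
  finally have sums: "(\<lambda>n. decay 1 n * (1 - cos (pi * real (Suc n) * t))) sums
      (pi\<^sup>2 * (t / 2 - t\<^sup>2 / 4))" .
  have "(\<Sum>n<N. decay 1 n * (1 - cos (pi * real (Suc n) * t))) \<le> pi\<^sup>2 * (t / 2 - t\<^sup>2 / 4)"
    unfolding sums_unique[OF sums] by (intro sum_le_suminf sums_summable[OF sums] nonneg) auto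
  also have "\<dots> \<le> pi\<^sup>2 * (t / 2)" by (intro mult_left_mono) auto
  finally show ?thesis by simp
next
  case False
  have "(\<Sum>n<N. decay 1 n * (1 - cos (pi * real (Suc n) * t))) \<le> (\<Sum>n<N. decay 1 n * 2)"
  proof (intro sum_mono mult_left_mono decay_nonneg)
    show "1 - cos u \<le> 2" for u :: real using cos_ge_minus_one[of u] by linarith
  qed
  also have "\<dots> = 2 * (\<Sum>n<N. decay 1 n)" by (simp add: sum_distrib_left mult.commute)
  also have "(\<Sum>n<N. decay 1 n) \<le> pi\<^sup>2 / 6"
    using sum_le_suminf[OF sums_summable[OF decay_1_sums], of "{..<N}"]
      decay_nonneg sums_unique[OF decay_1_sums] by simp
  also have "2 * (pi\<^sup>2 / 6) \<le> pi\<^sup>2 / 2 * t"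
    using False mult_left_mono[of 1 t "pi\<^sup>2 / 2"] by simp
  finally show ?thesis by simp
qed

section \<open>Functions outside the Korobov and the cosine space\<close>

lemma cos_not_dominated_on_kor:
  "\<not> dominated_on {0..1} (rank1 (\<lambda>x. cos (pi * x))) (one_plus \<gamma> (kor_core \<alpha>))"
proof
  assume dom: "dominated_on {0..1} (rank1 (\<lambda>x. cos (pi * x))) (one_plus \<gamma> (kor_core \<alpha>))"
  have "cos (2 * pi * real (Suc n)) = 1" for n
    using cos_2npi[of "Suc n"] by (simp only: mult_ac)
  hence "kor_core \<alpha> 0 1 = kor_core \<alpha> 0 0" "kor_core \<alpha> 1 1 = kor_core \<alpha> 0 0"
    by (simp_all add: decay_series_def kor_term_def del: of_nat_Suc)
  hence "cos (pi * 0) = cos (pi * 1)" by (intro dominated_on_rank1_eqI[OF dom]) auto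
  thus False by simp
qed

text \<open>A weighted sum of the difference quotients at 0 over the scales \<open>h, 2 * h, \<dots>, n * h\<close>, with weights
  \<open>1, 1 / 2, \<dots>, 1 / n\<close>. On \<open>sin (2 * pi * x)\<close> it is at least \<open>pi\<close> times the \<open>n\<close>-th harmonic number, while
  its squared norm in the dual of the cosine space is at most a multiple of that number.\<close>

definition diff_quotient_sum :: "nat \<Rightarrow> real \<Rightarrow> (real \<Rightarrow> real) \<Rightarrow> real" where
  "diff_quotient_sum n h f = (\<Sum>i<n. decay 1 i / h * (f (real (Suc i) * h) - f 0))"

definition diff_quotient_weight :: "nat \<Rightarrow> real \<Rightarrow> nat \<Rightarrow> real" where
  "diff_quotient_weight n h i = (case i of 0 \<Rightarrow> - (\<Sum>i<n. decay 1 i / h) | Suc i \<Rightarrow> decay 1 i / h)"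

lemma weighted_sum_diff_quotient_weight:
  "weighted_sum {..<Suc n} (diff_quotient_weight n h) (\<lambda>i. f (real i * h)) = diff_quotient_sum n h f"
  unfolding weighted_sum_def sum.lessThan_Suc_shift
  by (simp add: diff_quotient_weight_def diff_quotient_sum_def right_diff_distrib sum_subtractf
    sum_distrib_right)

lemma harm_eq_sum_decay_1: "harm n = (\<Sum>i<n. decay 1 i * real (Suc i))"
  unfolding harm_altdef by (simp add: decay_1 power2_eq_square inverse_eq_divide del: of_nat_Suc)

lemma sum_decay_1_diff_quotient_sum_cos_le:
  assumes "0 < h"
  shows "(\<Sum>k<N. decay 1 k * - diff_quotient_sum n h (\<lambda>x. cos (pi * real (Suc k) * x))) \<le>
      pi\<^sup>2 / 2 * harm n"
proof -
  have "(\<Sum>k<N. decay 1 k * - diff_quotient_sum n h (\<lambda>x. cos (pi * real (Suc k) * x))) =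
      (\<Sum>k<N. \<Sum>i<n. decay 1 i / h * (decay 1 k * (1 - cos (pi * real (Suc k) * (real (Suc i) * h)))))"
    unfolding diff_quotient_sum_def sum_negf[symmetric] sum_distrib_left
    by (intro sum.cong refl) (simp add: algebra_simps)
  also have "\<dots> =
      (\<Sum>i<n. decay 1 i / h * (\<Sum>k<N. decay 1 k * (1 - cos (pi * real (Suc k) * (real (Suc i) * h)))))"
    unfolding sum_distrib_left by (rule sum.swap)
  also have "\<dots> \<le> (\<Sum>i<n. decay 1 i / h * (pi\<^sup>2 / 2 * (real (Suc i) * h)))"
    using assms decay_nonneg by (intro sum_mono mult_left_mono sum_decay_1_one_minus_cos_le) auto
  also have "\<dots> = pi\<^sup>2 / 2 * harm n"
    unfolding harm_eq_sum_decay_1 sum_distrib_left using assms by (intro sum.cong refl) simp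
  finally show ?thesis .
qed

lemma diff_quotient_sum_cos_bounds:
  assumes h: "0 < h"
  shows "diff_quotient_sum n h (\<lambda>x. cos (pi * real (Suc k) * x)) \<le> 0"
    and "- diff_quotient_sum n h (\<lambda>x. cos (pi * real (Suc k) * x)) \<le> pi\<^sup>2 / 2 * real (Suc k)"
proof -
  have eq: "- diff_quotient_sum n h (\<lambda>x. cos (pi * real (Suc k) * x)) =
      (\<Sum>i<n. decay 1 i * (1 - cos (pi * real (Suc i) * (real (Suc k) * h)))) / h"
    unfolding diff_quotient_sum_def sum_negf[symmetric] sum_divide_distrib
    by (intro sum.cong refl) (simp add: algebra_simps diff_divide_distrib)
  have "0 \<le> - diff_quotient_sum n h (\<lambda>x. cos (pi * real (Suc k) * x))"
    unfolding eq using h decay_nonneg by (intro divide_nonneg_pos sum_nonneg mult_nonneg_nonneg) auto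
  thus "diff_quotient_sum n h (\<lambda>x. cos (pi * real (Suc k) * x)) \<le> 0" by simp
  have "- diff_quotient_sum n h (\<lambda>x. cos (pi * real (Suc k) * x)) \<le> (pi\<^sup>2 / 2 * (real (Suc k) * h)) / h"
    unfolding eq using h by (intro divide_right_mono sum_decay_1_one_minus_cos_le) auto
  thus "- diff_quotient_sum n h (\<lambda>x. cos (pi * real (Suc k) * x)) \<le> pi\<^sup>2 / 2 * real (Suc k)"
    using h by simp
qed

lemma decay_mult_Suc_le:
  assumes "\<alpha> \<ge> 3/2"
  shows "decay \<alpha> n * real (Suc n) \<le> decay 1 n"
proof -
  have "decay \<alpha> n * real (Suc n) = real (Suc n) powr (- 2 * \<alpha> + 1)"
    unfolding decay_def powr_add by simp
  also have "\<dots> \<le> real (Suc n) powr (- 2 * 1)" using assms by (intro powr_mono) auto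
  finally show ?thesis by (simp add: decay_def)
qed

lemma quad_form_diff_quotient_cos_core_le:
  assumes \<alpha>: "\<alpha> \<ge> 3/2" and h: "0 < h"
  shows "quad_form {..<Suc n} (diff_quotient_weight n h) (\<lambda>i j. cos_core \<alpha> (real i * h) (real j * h)) \<le>
      pi ^ 4 / 2 * harm n"
proof -
  define A where "A k = - diff_quotient_sum n h (\<lambda>x. cos (pi * real (Suc k) * x))" for k
  have A: "0 \<le> A k" "A k \<le> pi\<^sup>2 / 2 * real (Suc k)" for k
    using diff_quotient_sum_cos_bounds[OF h, of n k] by (simp_all add: A_def)
  have term_le: "decay \<alpha> k * (2 * (A k)\<^sup>2) \<le> pi\<^sup>2 * (decay 1 k * A k)" for k
  proof -
    have "decay \<alpha> k * (2 * (A k)\<^sup>2) = 2 * (decay \<alpha> k * A k) * A k" by (simp add: power2_eq_square)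
    also have "\<dots> \<le> 2 * (decay \<alpha> k * A k) * (pi\<^sup>2 / 2 * real (Suc k))"
      using A[of k] decay_nonneg[of \<alpha> k] by (intro mult_left_mono) auto
    also have "\<dots> = pi\<^sup>2 * A k * (decay \<alpha> k * real (Suc k))" by simp
    also have "\<dots> \<le> pi\<^sup>2 * A k * decay 1 k"
      using A[of k] by (intro mult_left_mono decay_mult_Suc_le \<alpha>) auto
    finally show ?thesis by (simp add: mult_ac)
  qed
  have form: "quad_form {..<Suc n} (diff_quotient_weight n h)
      (\<lambda>i j. cos_term k (real i * h) (real j * h)) = 2 * (A k)\<^sup>2" for k
    using weighted_sum_diff_quotient_weight[of n h "\<lambda>x. cos (pi * real (Suc k) * x)"]
    unfolding cos_term_def A_def quad_form_scale quad_form_rank1 by simp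
  have "(\<Sum>k<N. decay \<alpha> k * (2 * (A k)\<^sup>2)) \<le> pi ^ 4 / 2 * harm n" for N
  proof -
    have "(\<Sum>k<N. decay \<alpha> k * (2 * (A k)\<^sup>2)) \<le> pi\<^sup>2 * (\<Sum>k<N. decay 1 k * A k)"
      unfolding sum_distrib_left by (intro sum_mono term_le)
    also have "\<dots> \<le> pi\<^sup>2 * (pi\<^sup>2 / 2 * harm n)"
      unfolding A_def by (intro mult_left_mono sum_decay_1_diff_quotient_sum_cos_le h) auto
    finally show ?thesis by (simp add: power4_eq_xxxx power2_eq_square)
  qed
  moreover have "(\<lambda>i j. cos_core \<alpha> (real i * h) (real j * h)) =
      decay_series \<alpha> (\<lambda>k i j. cos_term k (real i * h) (real j * h))"
    by (simp add: decay_series_def fun_eq_iff)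
  ultimately show ?thesis
    using \<alpha> by (simp only:) (intro quad_form_decay_series_le[OF _ abs_cos_term_le], auto simp: form)
qed

lemma half_le_sin:
  fixes u :: real
  assumes "0 \<le> u" "u \<le> 1"
  shows "u / 2 \<le> sin u"
proof -
  have "sin 0 - 0 / 2 \<le> sin u - u / 2"
  proof (rule DERIV_nonneg_imp_nondecreasing[OF assms(1)])
    fix v assume v: "0 \<le> v" "v \<le> u"
    have "1 \<le> pi / 3" using pi_gt3 by simp
    hence "cos (pi / 3) \<le> cos v" using v assms by (intro cos_monotone_0_pi_le) auto
    moreover have "((\<lambda>v. sin v - v / 2) has_real_derivative cos v - 1 / 2) (at v)"
      by (auto intro!: derivative_eq_intros)
    ultimately show "\<exists>d. ((\<lambda>v. sin v - v / 2) has_real_derivative d) (at v) \<and> 0 \<le> d"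
      by (intro exI[of _ "cos v - 1 / 2"]) (simp add: cos_60)
  qed
  thus ?thesis by simp
qed

lemma diff_quotient_sum_sin_ge:
  assumes h: "0 < h" "8 * real n * h \<le> 1"
  shows "pi * harm n \<le> diff_quotient_sum n h (\<lambda>x. sin (2 * pi * x))"
proof -
  have "pi * harm n = (\<Sum>i<n. decay 1 i / h * (pi * real (Suc i) * h))"
    unfolding harm_eq_sum_decay_1 sum_distrib_left using h by (intro sum.cong refl) simp
  also have "\<dots> \<le> (\<Sum>i<n. decay 1 i / h * sin (2 * pi * (real (Suc i) * h)))"
  proof (intro sum_mono mult_left_mono)
    fix i assume "i \<in> {..<n}"
    hence "real (Suc i) * h \<le> real n * h" using h by (intro mult_right_mono) auto
    hence "real (Suc i) * h \<le> 1 / 8" using h(2) by linarith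
    hence "2 * pi * (real (Suc i) * h) \<le> 2 * 4 * (1 / 8)"
      by (intro mult_mono) (use h pi_less_4 in auto)
    thus "pi * real (Suc i) * h \<le> sin (2 * pi * (real (Suc i) * h))"
      using half_le_sin[of "2 * pi * (real (Suc i) * h)"] h by simp
  qed (use h decay_nonneg in auto)
  finally show ?thesis unfolding diff_quotient_sum_def by simp
qed

lemma harm_le_of_sin_bound:
  assumes \<alpha>: "\<alpha> \<ge> 3/2" and \<gamma>: "\<gamma> \<ge> 0" and C: "C \<ge> 0" and n: "n \<noteq> 0"
    and bound: "form_le_on {0..1} C (rank1 (\<lambda>x. sin (2 * pi * x))) (one_plus \<gamma> (cos_core \<alpha>))"
  shows "pi\<^sup>2 * harm n \<le> C * (\<gamma> * (pi ^ 4 / 2))"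
proof -
  define h where "h = 1 / (8 * real n)"
  have h: "0 < h" "8 * real n * h \<le> 1" using n by (simp_all add: h_def)
  have "real i * h \<le> 1" if "i < Suc n" for i
  proof -
    have "real i * h \<le> real n * h" using that h by (intro mult_right_mono) auto
    thus ?thesis using h by linarith
  qed
  hence grid: "(\<lambda>i. real i * h) ` {..<Suc n} \<subseteq> {0..1}" using h by auto
  let ?w = "diff_quotient_weight n h"
  have "(pi * harm n)\<^sup>2 \<le> (diff_quotient_sum n h (\<lambda>x. sin (2 * pi * x)))\<^sup>2"
    by (intro power_mono diff_quotient_sum_sin_ge h) (simp add: harm_nonneg)
  also have "\<dots> \<le> C * quad_form {..<Suc n} ?w (\<lambda>i j. 1 + \<gamma> * cos_core \<alpha> (real i * h) (real j * h))"
    unfolding weighted_sum_diff_quotient_weight[symmetric] quad_form_rank1[symmetric]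
    by (rule form_le_onD[OF form_le_on_pullback[OF bound grid]]) auto
  also have "quad_form {..<Suc n} ?w (\<lambda>i j. 1 + \<gamma> * cos_core \<alpha> (real i * h) (real j * h)) =
      \<gamma> * quad_form {..<Suc n} ?w (\<lambda>i j. cos_core \<alpha> (real i * h) (real j * h))"
    using quad_form_rank1[of "{..<Suc n}" ?w "\<lambda>_. 1"] weighted_sum_diff_quotient_weight[of n h "\<lambda>_. 1"]
    unfolding quad_form_add quad_form_scale diff_quotient_sum_def by simp
  also have "C * \<dots> \<le> C * (\<gamma> * (pi ^ 4 / 2 * harm n))"
    using C \<gamma> by (intro mult_left_mono quad_form_diff_quotient_cos_core_le \<alpha> h) auto
  finally have "pi\<^sup>2 * harm n * harm n \<le> C * (\<gamma> * (pi ^ 4 / 2)) * harm n"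
    by (simp add: power_mult_distrib power2_eq_square mult_ac)
  thus ?thesis using n by simp
qed

lemma sin_not_dominated_on_cos:
  assumes \<alpha>: "\<alpha> \<ge> 3/2" and \<gamma>: "\<gamma> \<ge> 0"
  shows "\<not> dominated_on {0..1} (rank1 (\<lambda>x. sin (2 * pi * x))) (one_plus \<gamma> (cos_core \<alpha>))"
proof
  assume "dominated_on {0..1} (rank1 (\<lambda>x. sin (2 * pi * x))) (one_plus \<gamma> (cos_core \<alpha>))"
  then obtain C where C: "C > 0" "form_le_on {0..1} C (rank1 (\<lambda>x. sin (2 * pi * x))) (one_plus \<gamma> (cos_core \<alpha>))"
    by (rule dominated_onE)
  define D where "D = C * (\<gamma> * (pi ^ 4 / 2))"
  have D: "0 \<le> D" using C(1) \<gamma> by (simp add: D_def)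
  obtain n where n: "D < harm n"
    using harm_at_top by (auto simp: filterlim_at_top_dense eventually_sequentially)
  hence "harm n > (0::real)" using D by linarith
  hence "n \<noteq> 0" by simp
  with \<alpha> \<gamma> less_imp_le[OF C(1)] have "pi\<^sup>2 * harm n \<le> D"
    unfolding D_def using C(2) by (rule harm_le_of_sin_bound)
  moreover have "1 * harm n \<le> pi\<^sup>2 * harm n"
    using pi_gt3 by (intro mult_right_mono harm_nonneg) (simp add: one_le_power)
  ultimately show False using n by simp
qed

section \<open>Products of kernels\<close>

definition axis_pt :: "real \<Rightarrow> nat \<Rightarrow> real" where
  "axis_pt t = (\<lambda>j. if j = 0 then t else 0)"

lemma axis_pt_0 [simp]: "axis_pt t 0 = t"
  by (simp add: axis_pt_def)

lemma prod_axis_pt: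
  fixes k :: "nat \<Rightarrow> real \<Rightarrow> real \<Rightarrow> real"
  assumes "s \<ge> 1"
  shows "(\<Prod>j<s. k j (axis_pt t j) (axis_pt u j)) = k 0 t u * (\<Prod>j\<in>{1..<s}. k j 0 0)"
proof -
  have "{..<s} = insert 0 {1..<s}" using assms by auto
  thus ?thesis by (simp add: axis_pt_def)
qed

lemma dominated_on_cube_axis:
  fixes l :: "nat \<Rightarrow> real \<Rightarrow> real \<Rightarrow> real"
  assumes s: "s \<ge> 1" and l: "\<And>j. j < s \<Longrightarrow> psd_on {0..1} (l j)"
    and dom: "dominated_on (unit_cube s) (\<lambda>x y. k (x 0) (y 0)) (\<lambda>x y. \<Prod>j<s. l j (x j) (y j))"
  shows "dominated_on {0..1} k (l 0)"
proof -
  define R where "R = (\<Prod>j\<in>{1..<s}. l j 0 0)"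
  have R: "0 \<le> R" unfolding R_def using l by (intro prod_nonneg psd_on_diag_nonneg[OF l]) auto
  have "axis_pt ` {0..1} \<subseteq> unit_cube s" using s by (auto simp: axis_pt_def unit_cube_def)
  from dominated_on_pullback[OF dom this]
  have axis: "dominated_on {0..1} k (\<lambda>t u. R * l 0 t u)"
    by (simp add: prod_axis_pt[OF s] R_def mult.commute)
  then obtain C where C: "C > 0" "form_le_on {0..1} C k (\<lambda>t u. R * l 0 t u)" by (rule dominated_onE)
  show ?thesis
  proof (rule dominated_onI)
    fix S c assume "finite S" "S \<subseteq> {0..1::real}"
    from form_le_onD[OF C(2) this, of c] show "quad_form S c k \<le> C * R * quad_form S c (l 0)"
      by (simp add: quad_form_scale mult.assoc)
  qed (use dominated_on_psd(1)[OF axis] l s C R in auto)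
qed

lemma rkhs_not_subset_prod:
  fixes k l :: "nat \<Rightarrow> real \<Rightarrow> real \<Rightarrow> real"
  assumes s: "s \<ge> 1" and f: "dominated_on {0..1} (rank1 f) (k 0)"
    and one: "\<And>j. j < s \<Longrightarrow> dominated_on {0..1} (\<lambda>x y. 1) (k j)"
    and l: "\<And>j. j < s \<Longrightarrow> psd_on {0..1} (l j)"
    and not: "\<not> dominated_on {0..1} (rank1 f) (l 0)"
  shows "rkhs_not_subset (real_kernel (\<lambda>x y. \<Prod>j<s. k j (x j) (y j)))
    (real_kernel (\<lambda>x y. \<Prod>j<s. l j (x j) (y j))) (unit_cube s)"
proof -
  define F where "F j = (if j = 0 then rank1 f else (\<lambda>x y. 1))" for j :: nat
  have "dominated_on (unit_cube s) (\<lambda>x y. \<Prod>j<s. F j (x j) (y j)) (\<lambda>x y. \<Prod>j<s. k j (x j) (y j))"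
    by (rule dominated_on_cube) (use f one in \<open>auto simp: F_def\<close>)
  moreover have "(\<Prod>j<s. F j (x j) (y j)) = f (x 0) * f (y 0)" for x y
  proof -
    have "(\<Prod>j<s. F j (x j) (y j)) = (\<Prod>j\<in>{0}. F j (x j) (y j))"
      by (rule prod.mono_neutral_right) (use s in \<open>auto simp: F_def\<close>)
    thus ?thesis by (simp add: F_def)
  qed
  ultimately have dom: "dominated_on (unit_cube s) (rank1 (\<lambda>x. f (x 0)))
      (\<lambda>x y. \<Prod>j<s. k j (x j) (y j))" by simp
  have psd: "psd_on (unit_cube s) (\<lambda>x y. \<Prod>j<s. l j (x j) (y j))"
    using dominated_on_cube[of s l l] dominated_on_refl l by (blast dest: dominated_on_psd(1))
  have "\<not> dominated_on (unit_cube s) (rank1 (\<lambda>x. f (x 0))) (\<lambda>x y. \<Prod>j<s. l j (x j) (y j))"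
    using dominated_on_cube_axis[OF s, where l = l and k = "rank1 f"] l not by blast
  thus ?thesis
    using dom unfolding rkhs_not_subset_def real_fun_in_rkhs_iff[OF psd, symmetric]
      real_fun_in_rkhs_iff[OF dominated_on_psd(2)[OF dom], symmetric] by blast
qed

lemma dominated_on_one_plus:
  assumes kl: "dominated_on X k l" and \<gamma>: "\<gamma> > 0"
  shows "dominated_on X k (one_plus \<gamma> l)" "dominated_on X (\<lambda>x y. 1) (one_plus \<gamma> l)"
    "dominated_on X (one_plus \<gamma> k) (one_plus \<gamma> l)"
proof -
  note psd = dominated_on_psd[OF kl]
  have l: "psd_on X (\<lambda>x y. \<gamma> * l x y)" using psd \<gamma> by (intro psd_on_scale) auto
  show one: "dominated_on X (\<lambda>x y. 1) (one_plus \<gamma> l)"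
    by (rule dominated_on_add_right[OF psd_on_one l])
  have "dominated_on X (\<lambda>x y. \<gamma> * l x y) (one_plus \<gamma> l)"
    using dominated_on_add_right[OF l psd_on_one] by (simp add: add.commute)
  moreover have "dominated_on X l (\<lambda>x y. \<gamma> * l x y)"
    using dominated_on_scale[OF psd(2), of 1 \<gamma>] \<gamma> by simp
  ultimately show k: "dominated_on X k (one_plus \<gamma> l)"
    using kl dominated_on_trans by blast
  have "dominated_on X (\<lambda>x y. \<gamma> * k x y) k" using dominated_on_scale[OF psd(1), of \<gamma> 1] \<gamma> by simp
  hence "dominated_on X (\<lambda>x y. \<gamma> * k x y) (one_plus \<gamma> l)" using k dominated_on_trans by blast
  with one show "dominated_on X (one_plus \<gamma> k) (one_plus \<gamma> l)" by (rule dominated_on_add)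
qed

lemma prod_kernel_eq:
  assumes "has_core K k"
  shows "prod_kernel K s \<gamma> = real_kernel (\<lambda>x y. \<Prod>j<s. 1 + \<gamma> j * k (x j) (y j))"
  using assms by (simp add: prod_kernel_def has_core_def fun_eq_iff)

lemma rkhs_not_subset_mono:
  "rkhs_embeds K L X \<Longrightarrow> rkhs_not_subset K M X \<Longrightarrow> rkhs_not_subset L M X"
  by (auto simp: rkhs_embeds_def rkhs_not_subset_def)

locale positive_weights =
  fixes s :: nat and \<gamma> :: "nat \<Rightarrow> real"
  assumes dim_pos: "s \<ge> 1" and weight_pos: "\<forall>j<s. \<gamma> j > 0"
begin

abbreviation "embeds K L \<equiv> rkhs_embeds (prod_kernel K s \<gamma>) (prod_kernel L s \<gamma>) (unit_cube s)"
abbreviation "not_subset K L \<equiv> rkhs_not_subset (prod_kernel K s \<gamma>) (prod_kernel L s \<gamma>) (unit_cube s)"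

lemma embeds_of_dominated_on:
  assumes K: "has_core K k" and L: "has_core L l" and kl: "dominated_on {0..1} k l"
  shows "embeds K L"
  unfolding prod_kernel_eq[OF K] prod_kernel_eq[OF L]
  by (rule rkhs_embeds_of_dominated_on,
      rule dominated_on_cube[of s "\<lambda>j. one_plus (\<gamma> j) k" "\<lambda>j. one_plus (\<gamma> j) l"])
     (use dominated_on_one_plus(3)[OF kl] weight_pos in auto)

lemma not_subset_of_not_dominated_on:
  assumes K: "has_core K k" and L: "has_core L l"
    and l: "psd_on {0..1} l" and f: "dominated_on {0..1} (rank1 f) k"
    and not: "\<not> dominated_on {0..1} (rank1 f) (one_plus (\<gamma> 0) l)"
  shows "not_subset K L"
  unfolding prod_kernel_eq[OF K] prod_kernel_eq[OF L]
proof (rule rkhs_not_subset_prod[where f = f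
      and k = "\<lambda>j. one_plus (\<gamma> j) k" and l = "\<lambda>j. one_plus (\<gamma> j) l"])
  show "dominated_on {0..1} (rank1 f) (one_plus (\<gamma> 0) k)"
    by (rule dominated_on_one_plus(1)[OF f]) (use dim_pos weight_pos in simp)
  show "dominated_on {0..1} (\<lambda>x y. 1) (one_plus (\<gamma> j) k)" if "j < s" for j
    by (rule dominated_on_one_plus(2)[OF f]) (use that weight_pos in simp)
  show "psd_on {0..1} (one_plus (\<gamma> j) l)" if "j < s" for j
    using that weight_pos by (intro psd_on_add psd_on_one psd_on_scale l) auto
qed (fact dim_pos not)+

lemma kor_embeds_korcos: "\<alpha> > 1/2 \<Longrightarrow> embeds (K_kor \<alpha>) (K_korcos \<alpha>)"
  by (rule embeds_of_dominated_on[OF has_core_K_kor has_core_K_korcos kor_core_dominated_on_korcos_core])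

lemma cos_embeds_korcos: "\<alpha> > 1/2 \<Longrightarrow> embeds (K_cos \<alpha>) (K_korcos \<alpha>)"
  by (rule embeds_of_dominated_on[OF has_core_K_cos has_core_K_korcos cos_core_dominated_on_korcos_core])

lemma kor_embeds_sob: "a \<ge> 1 \<Longrightarrow> embeds (K_kor (real a)) (K_sob a)"
  by (rule embeds_of_dominated_on[OF has_core_K_kor has_core_K_sob kor_core_dominated_on_sob_core]) auto

lemma cos_embeds_sob: "a \<ge> 1 \<Longrightarrow> embeds (K_cos (real a)) (K_sob a)"
  by (rule embeds_of_dominated_on[OF has_core_K_cos has_core_K_sob cos_core_dominated_on_sob_core]) auto

lemma korcos_embeds_sob: "a \<ge> 1 \<Longrightarrow> embeds (K_korcos (real a)) (K_sob a)"
  by (rule embeds_of_dominated_on[OF has_core_K_korcos has_core_K_sob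
        korcos_core_dominated_on[OF kor_core_dominated_on_sob_core cos_core_dominated_on_sob_core]]) auto

lemma sob_embeds_cos: "embeds (K_sob 1) (K_cos 1)"
  by (rule embeds_of_dominated_on[OF has_core_K_sob has_core_K_cos sob_core_1_dominated_on_cos_core])
    simp

lemma korcos_embeds_cos: "embeds (K_korcos 1) (K_cos 1)"
proof (rule embeds_of_dominated_on[OF has_core_K_korcos has_core_K_cos korcos_core_dominated_on])
  show "dominated_on {0..1} (kor_core 1) (cos_core 1)"
    using dominated_on_trans[OF kor_core_dominated_on_sob_core[of 1] sob_core_1_dominated_on_cos_core]
    by simp
  show "dominated_on {0..1} (cos_core 1) (cos_core 1)"
    by (rule dominated_on_refl[OF psd_on_cos_core]) simp
qed auto

lemma cos_not_subset_kor: "\<alpha> > 1/2 \<Longrightarrow> not_subset (K_cos \<alpha>) (K_kor \<alpha>)"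
  by (rule not_subset_of_not_dominated_on[OF has_core_K_cos has_core_K_kor psd_on_kor_core
        cos_dominated_on_cos_core cos_not_dominated_on_kor])

lemma kor_not_subset_cos: "\<alpha> \<ge> 3/2 \<Longrightarrow> not_subset (K_kor \<alpha>) (K_cos \<alpha>)"
  by (rule not_subset_of_not_dominated_on[OF has_core_K_kor has_core_K_cos psd_on_cos_core
        sin_dominated_on_kor_core sin_not_dominated_on_cos]) (use dim_pos weight_pos in auto)

end

theorem mainTheorem2:
  fixes s :: nat and \<gamma> :: "nat \<Rightarrow> real"
  assumes "s \<ge> 1" and "\<forall>j<s. \<gamma> j > 0"
  shows
   "(let X = unit_cube s;
         Kkor = (\<lambda>\<alpha>. prod_kernel (K_kor \<alpha>) s \<gamma>);
         Kcos = (\<lambda>\<alpha>. prod_kernel (K_cos \<alpha>) s \<gamma>);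
         Kkc  = (\<lambda>\<alpha>. prod_kernel (K_korcos \<alpha>) s \<gamma>);
         Ksob = (\<lambda>a::nat. prod_kernel (K_sob a) s \<gamma>)
     in
     \<comment> \<open>(i) alpha = 1\<close>
     (rkhs_embeds (Kkor 1) (Ksob 1) X \<and>
      rkhs_equiv (Ksob 1) (Kcos 1) X \<and>
      rkhs_equiv (Kcos 1) (Kkc 1) X \<and>
      rkhs_not_subset (Ksob 1) (Kkor 1) X \<and>
      rkhs_not_subset (Kcos 1) (Kkor 1) X \<and>
      rkhs_not_subset (Kkc 1) (Kkor 1) X) \<and>
     \<comment> \<open>(ii) integer alpha > 1\<close>
     (\<forall>a::nat. a > 1 \<longrightarrow>
        rkhs_embeds (Kkor (real a)) (Kkc (real a)) X \<and>
        rkhs_embeds (Kcos (real a)) (Kkc (real a)) X \<and>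
        rkhs_embeds (Kkc (real a)) (Ksob a) X) \<and>
     \<comment> \<open>(iii) real alpha\<close>
     (\<forall>\<alpha>::real. \<alpha> > 1/2 \<longrightarrow>
        rkhs_not_subset (Kcos \<alpha>) (Kkor \<alpha>) X \<and>
        rkhs_not_subset (Kkc \<alpha>) (Kkor \<alpha>) X) \<and>
     (\<forall>\<alpha>::real. \<alpha> \<ge> 3/2 \<longrightarrow>
        rkhs_not_subset (Kkc \<alpha>) (Kcos \<alpha>) X \<and>
        rkhs_not_subset (Kkor \<alpha>) (Kcos \<alpha>) X))"
proof -
  interpret positive_weights s \<gamma> using assms by unfold_locales
  have "not_subset (K_sob 1) (K_kor 1)"
    using rkhs_not_subset_mono[OF cos_embeds_sob[of 1] cos_not_subset_kor] by simp
  moreover have "not_subset (K_korcos \<alpha>) (K_kor \<alpha>)" if "\<alpha> > 1/2" for \<alpha>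
    using that by (intro rkhs_not_subset_mono[OF cos_embeds_korcos cos_not_subset_kor])
  moreover have "not_subset (K_korcos \<alpha>) (K_cos \<alpha>)" if "\<alpha> \<ge> 3/2" for \<alpha>
    using that by (intro rkhs_not_subset_mono[OF kor_embeds_korcos kor_not_subset_cos]) auto
  ultimately show ?thesis
    using kor_embeds_sob[of 1] cos_embeds_sob[of 1] sob_embeds_cos korcos_embeds_cos
      kor_embeds_korcos cos_embeds_korcos korcos_embeds_sob cos_not_subset_kor kor_not_subset_cos
    unfolding Let_def rkhs_equiv_def by simp
qed

end
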